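(* Let $\mathcal{M}$ be a von Neumann algebra. (1) If $(x_\alpha)_{\alpha\in\Lambda}$ is a decreasing net in $(\mathcal{M}_{sa},\preceq)$ with a lower bound in $(\mathcal{M}_{sa},\preceq)$, then $\inf_{\alpha\in\Lambda}x_\alpha=\operatorname{s-lim}_{\alpha\in\Lambda}x_\alpha$. (2) If $(x_\alpha)_{\alpha\in\Lambda}$ is an increasing net in $(\mathcal{M}_{sa},\preceq)$ with an upper bound in $(\mathcal{M}_{sa},\preceq)$, then $\sup_{\alpha\in\Lambda}x_\alpha=\operatorname{s-lim}_{\alpha\in\Lambda}x_\alpha$. Here the infimum and the supremum are taken in $(\mathcal{M}_{sa},\preceq)$, where $\preceq$ is the spectral order, and $\operatorname{s-lim}$ is the limit in the strong operator topology.
   Context: A von Neumann algebra $\mathcal{M}$ is a strongly operator closed C*-subalgebra of $\mathcal{B}(\mathcal{H})$, the algebra of bounded operators on a complex Hilbert space $\mathcal{H}$; $\mathbf{1}$ is its unit and $\mathcal{M}_{sa}$ is its self-adjoint part. For $x\in\mathcal{M}_{sa}$, $(E^x_\lambda)_{\lambda\in\mathbb{R}}$ denotes its (right-continuous) spectral family in $\mathcal{M}$: $E^x_\lambda$ is the spectral projection of $x$ for $(-\infty,\lambda]$, so $E^x_\lambda\le E^x_\mu$ for $\lambda\le\mu$, $E^x_\lambda=\inf_{\mu>\lambda}E^x_\mu$, and $E^x_\lambda=0$ for $\lambda<-a$, $E^x_\lambda=\mathbf{1}$ for $\lambda>a$, for some $a>0$. The spectral order $\preceq$ on $\mathcal{M}_{sa}$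 is defined by: $x\preceq y$ iff $E^y_\lambda\le E^x_\lambda$ for every $\lambda\in\mathbb{R}$. The poset $(\mathcal{M}_{sa},\preceq)$ is a conditionally complete lattice (every nonempty order bounded subset has a supremum and an infimum; indeed nonempty sets bounded above have suprema and nonempty sets bounded below have infima). *)

theory Defs
  imports "HOL-Analysis.Analysis" "HOL-Algebra.Lattice"
begin

section \<open>Complex Hilbert spaces\<close>

text \<open>
  The inner product is linear in the first argument. Completeness and the compatibility of the
  norm with the real vector space structure come from \<^class>\<open>banach\<close>.
\<close>

class chilbert_space = banach +
  fixes scaleC :: "complex \<Rightarrow> 'a \<Rightarrow> 'a"  (infixr \<open>*\<^sub>C\<close> 75)
    and cinner :: "'a \<Rightarrow> 'a \<Rightarrow> complex"
  assumes scaleC_add_right: "c *\<^sub>C (x + y) = c *\<^sub>C x + c *\<^sub>C y"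
    and scaleC_add_left: "(c + d) *\<^sub>C x = c *\<^sub>C x + d *\<^sub>C x"
    and scaleC_scaleC: "c *\<^sub>C d *\<^sub>C x = (c * d) *\<^sub>C x"
    and scaleR_eq_scaleC: "r *\<^sub>R x = complex_of_real r *\<^sub>C x"
    and cinner_commute: "cinner x y = cnj (cinner y x)"
    and cinner_add_left: "cinner (x + y) z = cinner x z + cinner y z"
    and cinner_scaleC_left: "cinner (c *\<^sub>C x) y = c * cinner x y"
    and cinner_self: "cinner x x = complex_of_real ((norm x)\<^sup>2)"

instantiation complex :: chilbert_space
begin

definition scaleC_complex :: "complex \<Rightarrow> complex \<Rightarrow> complex"
  where "scaleC_complex c x = c * x"

definition cinner_complex :: "complex \<Rightarrow> complex \<Rightarrow> complex"
  where "cinner_complex x y = x * cnj y"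

instance
proof
  fix c d x y z :: complex and r :: real
  show "c *\<^sub>C (x + y) = c *\<^sub>C x + c *\<^sub>C y" by (simp add: scaleC_complex_def distrib_left)
  show "(c + d) *\<^sub>C x = c *\<^sub>C x + d *\<^sub>C x" by (simp add: scaleC_complex_def distrib_right)
  show "c *\<^sub>C d *\<^sub>C x = (c * d) *\<^sub>C x" by (simp add: scaleC_complex_def)
  show "r *\<^sub>R x = complex_of_real r *\<^sub>C x" by (simp add: scaleC_complex_def scaleR_conv_of_real)
  show "cinner x y = cnj (cinner y x)" by (simp add: cinner_complex_def)
  show "cinner (x + y) z = cinner x z + cinner y z"
    by (simp add: cinner_complex_def distrib_right)
  show "cinner (c *\<^sub>C x) y = c * cinner x y" by (simp add: cinner_complex_def scaleC_complex_def)
  show "cinner x x = complex_of_real ((norm x)\<^sup>2)"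
    unfolding cinner_complex_def by (rule complex_norm_square[symmetric])
qed

end

section \<open>Bounded operators\<close>

text \<open>
  The type of the library's bounded linear maps consists of the real linear ones, so
  \<open>\<B>(\<H>)\<close> is the subset of those that are complex linear. Norm, real
  linear structure and composition are those of the ambient type.
\<close>

definition bounded_ops :: "('h::chilbert_space \<Rightarrow>\<^sub>L 'h) set"
  where "bounded_ops = {T. \<forall>c \<xi>. blinfun_apply T (c *\<^sub>C \<xi>) = c *\<^sub>C blinfun_apply T \<xi>}"

definition op_scaleC :: "complex \<Rightarrow> ('h::chilbert_space \<Rightarrow>\<^sub>L 'h) \<Rightarrow> 'h \<Rightarrow>\<^sub>L 'h"
  where "op_scaleC c T = Blinfun (\<lambda>\<xi>. c *\<^sub>C blinfun_apply T \<xi>)"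

definition adj :: "('h::chilbert_space \<Rightarrow>\<^sub>L 'h) \<Rightarrow> 'h \<Rightarrow>\<^sub>L 'h"
  where "adj T = (THE S. \<forall>\<xi> \<eta>. cinner (blinfun_apply T \<xi>) \<eta> = cinner \<xi> (blinfun_apply S \<eta>))"

definition positive_op :: "('h::chilbert_space \<Rightarrow>\<^sub>L 'h) \<Rightarrow> bool"
  where "positive_op T \<longleftrightarrow> T \<in> bounded_ops \<and> (\<forall>\<xi>. cinner (blinfun_apply T \<xi>) \<xi> \<in> \<real>\<^sub>\<ge>\<^sub>0)"

definition op_le :: "('h::chilbert_space \<Rightarrow>\<^sub>L 'h) \<Rightarrow> ('h \<Rightarrow>\<^sub>L 'h) \<Rightarrow> bool"
  where "op_le S T \<longleftrightarrow> positive_op (T - S)"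

definition sot :: "('h::chilbert_space \<Rightarrow>\<^sub>L 'h) topology"
  where "sot = subtopology strong_operator_topology bounded_ops"

section \<open>Von Neumann algebras\<close>

definition cstar_subalgebra :: "('h::chilbert_space \<Rightarrow>\<^sub>L 'h) set \<Rightarrow> bool"
  where "cstar_subalgebra M \<longleftrightarrow>
    M \<subseteq> bounded_ops \<and> 0 \<in> M \<and>
    (\<forall>S\<in>M. \<forall>T\<in>M. S + T \<in> M) \<and>
    (\<forall>c. \<forall>T\<in>M. op_scaleC c T \<in> M) \<and>
    (\<forall>S\<in>M. \<forall>T\<in>M. S o\<^sub>L T \<in> M) \<and>
    (\<forall>T\<in>M. adj T \<in> M) \<and>
    closed M"

definition von_neumann_algebra :: "('h::chilbert_space \<Rightarrow>\<^sub>L 'h) set \<Rightarrow> bool"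
  where "von_neumann_algebra M \<longleftrightarrow> cstar_subalgebra M \<and> closedin sot M"

text \<open>
  A strongly closed C*-subalgebra has a unit, which is a projection but need not be the
  identity operator of the Hilbert space. Everything below refers to the unit of the algebra.
\<close>

definition alg_unit :: "('h::chilbert_space \<Rightarrow>\<^sub>L 'h) set \<Rightarrow> 'h \<Rightarrow>\<^sub>L 'h"
  where "alg_unit M = (THE e. e \<in> M \<and> (\<forall>T\<in>M. e o\<^sub>L T = T \<and> T o\<^sub>L e = T))"

definition sa_part :: "('h::chilbert_space \<Rightarrow>\<^sub>L 'h) set \<Rightarrow> ('h \<Rightarrow>\<^sub>L 'h) set"
  where "sa_part M = {x \<in> M. adj x = x}"

definition projections :: "('h::chilbert_space \<Rightarrow>\<^sub>L 'h) set \<Rightarrow> ('h \<Rightarrow>\<^sub>L 'h) set"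
  where "projections M = {p \<in> M. adj p = p \<and> p o\<^sub>L p = p}"

definition projection_poset :: "('h::chilbert_space \<Rightarrow>\<^sub>L 'h) set \<Rightarrow> ('h \<Rightarrow>\<^sub>L 'h) gorder"
  where "projection_poset M = \<lparr>carrier = projections M, eq = (=), le = op_le\<rparr>"

section \<open>Spectral families and the spectral order\<close>

text \<open>
  The norm convergent Riemann--Stieltjes integral of the function \<open>\<lambda>\<close> with respect to \<open>E\<close> over
  the interval from \<open>a\<close> to \<open>b\<close>. The condition \<open>fine\<close> puts each cell of the
  partition into the ball of radius \<open>\<delta>\<close> around its tag, with \<open>\<delta>\<close> constant.
\<close>

definition has_spectral_integral ::
    "(real \<Rightarrow> 'h::chilbert_space \<Rightarrow>\<^sub>L 'h) \<Rightarrow> real \<Rightarrow> real \<Rightarrow> ('h \<Rightarrow>\<^sub>L 'h) \<Rightarrow> bool"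
  where "has_spectral_integral E a b x \<longleftrightarrow>
    (\<forall>\<epsilon>>0. \<exists>\<delta>>0. \<forall>p. p tagged_division_of {a..b} \<and> (\<lambda>t. ball t \<delta>) fine p \<longrightarrow>
      norm ((\<Sum>(t, K)\<in>p. t *\<^sub>R (E (Sup K) - E (Inf K))) - x) < \<epsilon>)"

definition is_spectral_family ::
    "('h::chilbert_space \<Rightarrow>\<^sub>L 'h) set \<Rightarrow> ('h \<Rightarrow>\<^sub>L 'h) \<Rightarrow> (real \<Rightarrow> 'h \<Rightarrow>\<^sub>L 'h) \<Rightarrow> bool"
  where "is_spectral_family M x E \<longleftrightarrow>
    (\<forall>l. E l \<in> projections M) \<and>
    (\<forall>l m. l \<le> m \<longrightarrow> op_le (E l) (E m)) \<and>
    (\<forall>l. is_glb (projection_poset M) (E l) (E ` {l<..})) \<and>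
    (\<exists>a>0. (\<forall>l. l < - a \<longrightarrow> E l = 0) \<and> (\<forall>l. a < l \<longrightarrow> E l = alg_unit M) \<and>
      (\<forall>l m. l < - a \<and> a < m \<longrightarrow> has_spectral_integral E l m x))"

text \<open>
  By the spectral theorem each self-adjoint element of a von Neumann algebra has exactly one
  spectral family, and its value at \<open>\<lambda>\<close> is the spectral projection for the interval
  of all reals up to and including \<open>\<lambda>\<close>.
\<close>

definition spectral_family ::
    "('h::chilbert_space \<Rightarrow>\<^sub>L 'h) set \<Rightarrow> ('h \<Rightarrow>\<^sub>L 'h) \<Rightarrow> real \<Rightarrow> 'h \<Rightarrow>\<^sub>L 'h"
  where "spectral_family M x = (THE E. is_spectral_family M x E)"

definition spectral_le ::
    "('h::chilbert_space \<Rightarrow>\<^sub>L 'h) set \<Rightarrow> ('h \<Rightarrow>\<^sub>L 'h) \<Rightarrow> ('h \<Rightarrow>\<^sub>L 'h) \<Rightarrow> bool"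
  where "spectral_le M x y \<longleftrightarrow> (\<forall>l. op_le (spectral_family M y l) (spectral_family M x l))"

definition spectral_poset :: "('h::chilbert_space \<Rightarrow>\<^sub>L 'h) set \<Rightarrow> ('h \<Rightarrow>\<^sub>L 'h) gorder"
  where "spectral_poset M = \<lparr>carrier = sa_part M, eq = (=), le = spectral_le M\<rparr>"

section \<open>Nets\<close>

definition directed_set :: "'i set \<Rightarrow> ('i \<Rightarrow> 'i \<Rightarrow> bool) \<Rightarrow> bool"
  where "directed_set I r \<longleftrightarrow> I \<noteq> {} \<and> reflp_on I r \<and> transp_on I r \<and>
    (\<forall>a\<in>I. \<forall>b\<in>I. \<exists>c\<in>I. r a c \<and> r b c)"

definition net_filter :: "'i set \<Rightarrow> ('i \<Rightarrow> 'i \<Rightarrow> bool) \<Rightarrow> 'i filter"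
  where "net_filter I r = (INF a\<in>I. principal {b \<in> I. r a b})"

lemma eventually_net_filter:
  assumes "directed_set I r"
  shows "eventually P (net_filter I r) \<longleftrightarrow> (\<exists>a\<in>I. \<forall>b\<in>I. r a b \<longrightarrow> P b)"
proof -
  have dir: "\<exists>c\<in>I. principal {d \<in> I. r c d} \<le>
      Lattices.inf (principal {d \<in> I. r a d}) (principal {d \<in> I. r b d})"
    if ab: "a \<in> I" "b \<in> I" for a b
  proof -
    obtain c where c: "c \<in> I" "r a c" "r b c"
      using assms ab unfolding directed_set_def by blast
    have "{d \<in> I. r c d} \<subseteq> {d \<in> I. r a d} \<inter> {d \<in> I. r b d}"
      using assms ab c unfolding directed_set_def transp_on_def by blast
    with c(1) show ?thesis by (intro bexI[of _ c]) simp_all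
  qed
  have "I \<noteq> {}" using assms by (simp add: directed_set_def)
  then have "eventually P (net_filter I r) \<longleftrightarrow>
      (\<exists>a\<in>I. eventually P (principal {b \<in> I. r a b}))"
    unfolding net_filter_def by (rule eventually_INF_base) (rule dir)
  then show ?thesis unfolding eventually_principal by blast
qed

end

theory Submission
  imports Defs
begin

text \<open>
  The spectral order compares spectral projections, so the idea is to describe these projections
  by inequalities that survive strong limits. Call a projection \<open>P\<close> of the algebra a
  \<^emph>\<open>cut\<close> of \<open>x\<close> at \<open>l\<close> if \<open>P\<close> commutes with \<open>x\<close>, \<open>x \<le> l\<close> holds on the range of \<open>P\<close>, and
  \<open>x \<ge> l\<close> holds on its complement below the unit (\<open>spectral_cut\<close>). A cut at \<open>l\<close> lies below every
  cut at a larger number (\<open>spectral_cut_mono\<close>), so cuts at the same number differ at most by a part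
  of the eigenspace, and the spectral family of \<open>x\<close> is the only right-continuous choice of cuts
  (\<open>is_spectral_family_iff\<close>, \<open>spectral_family_unique\<close>).

  For a monotone net \<open>x\<close> in the spectral order and a fixed \<open>l\<close>, the spectral projections of the
  \<open>x i\<close> at \<open>l\<close> form a monotone net of projections, which converges strongly to its
  supremum or infimum \<open>F l\<close>. The bound of the net and one of its members confine the spectra of a
  tail to one bounded interval. On it a single Riemann sum approximates every \<open>x i\<close> in norm up to
  the mesh (\<open>riemann_sum_error\<close>), and for a fixed partition the Riemann sums converge strongly.
  Hence \<open>x\<close> converges strongly to some \<open>X\<close>. Cuts pass to strong limits
  (\<open>spectral_cut_limit\<close>), so \<open>F l\<close> is a cut of \<open>X\<close> at \<open>l\<close>, and the spectral family \<open>G\<close> of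
  \<open>X\<close> is the right-continuous regularization of \<open>F\<close>, characterized by \<open>F l \<le> G l \<le> F m\<close> for
  \<open>l < m\<close> (\<open>spectral_family_net_limit\<close>). These inequalities say that \<open>X\<close> is the infimum or the
  supremum of the net.

  That self-adjoint elements have spectral families at all rests on the sign of a self-adjoint
  contraction \<open>T\<close>. It is the strong limit of the Newton--Schulz iteration
  \<open>t \<mapsto> (3 t - t\<^sup>3) / 2\<close> started at \<open>T\<close>, whose squares increase and stay below \<open>1\<close>
  (\<open>sign_operator\<close>). The iterates are polynomials without constant term, so the limit stays in the
  algebra even before a unit is known. Its square is a support projection of \<open>T\<close>; the supports
  make the projections of the algebra a directed set, whose supremum is the unit
  (\<open>exists_unit\<close>). Applied to \<open>x - l\<close>, the sign gives a cut of \<open>x\<close> at \<open>l\<close>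
  (\<open>exists_spectral_cut\<close>).
\<close>

section \<open>The underlying real inner product\<close>

text \<open>
  Self-adjointness, positivity and norms of complex linear operators are all visible in the real
  part of the inner product, and real quadratic forms can be compared by inequalities.
\<close>

definition rinner :: "'h::chilbert_space \<Rightarrow> 'h \<Rightarrow> real"
  where "rinner \<xi> \<eta> = Re (cinner \<xi> \<eta>)"

lemma rinner_commute: "rinner \<xi> \<eta> = rinner \<eta> \<xi>"
  unfolding rinner_def by (subst cinner_commute) simp

lemma rinner_add_left: "rinner (\<xi> + \<eta>) \<zeta> = rinner \<xi> \<zeta> + rinner \<eta> \<zeta>"
  by (simp add: rinner_def cinner_add_left)

lemma rinner_scaleR_left: "rinner (r *\<^sub>R \<xi>) \<eta> = r * rinner \<xi> \<eta>"
  by (simp add: rinner_def scaleR_eq_scaleC cinner_scaleC_left)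

lemma rinner_self: "rinner \<xi> \<xi> = (norm \<xi>)\<^sup>2"
  by (simp add: rinner_def cinner_self)

lemma rinner_add_right: "rinner \<zeta> (\<xi> + \<eta>) = rinner \<zeta> \<xi> + rinner \<zeta> \<eta>"
  by (metis rinner_add_left rinner_commute)

lemma rinner_scaleR_right: "rinner \<xi> (r *\<^sub>R \<eta>) = r * rinner \<xi> \<eta>"
  by (metis rinner_scaleR_left rinner_commute)

lemma abs_rinner_le: "\<bar>rinner \<xi> \<eta>\<bar> \<le> norm \<xi> * norm \<eta>"
proof (cases "\<eta> = 0")
  case True
  then show ?thesis using rinner_scaleR_right[of \<xi> 0 \<eta>] by simp
next
  case False
  define n where "n = (norm \<eta>)\<^sup>2"
  define b where "b = rinner \<xi> \<eta>"
  have n: "n > 0" using False by (simp add: n_def)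
  \<comment> \<open>the squared distance from \<open>n \<xi>\<close> to its projection onto the line of \<open>\<eta>\<close>\<close>
  have "0 \<le> (norm (n *\<^sub>R \<xi> + (- b) *\<^sub>R \<eta>))\<^sup>2" by simp
  also have "\<dots> = n * n * (norm \<xi>)\<^sup>2 - 2 * n * b * b + b * b * n"
    unfolding rinner_self[symmetric]
    by (simp only: rinner_add_left rinner_add_right rinner_scaleR_left rinner_scaleR_right
        rinner_commute[of \<eta> \<xi>] b_def[symmetric])
      (simp add: rinner_self n_def algebra_simps)
  also have "\<dots> = n * (n * (norm \<xi>)\<^sup>2 - b\<^sup>2)" by (simp add: algebra_simps power2_eq_square)
  finally have "b\<^sup>2 \<le> n * (norm \<xi>)\<^sup>2" using n by (simp add: zero_le_mult_iff)
  then have "b\<^sup>2 \<le> (norm \<xi> * norm \<eta>)\<^sup>2" by (simp add: n_def power_mult_distrib mult.commute)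
  then show ?thesis unfolding b_def by (metis abs_le_square_iff abs_mult abs_norm_cancel)
qed

interpretation rinner: bounded_bilinear "rinner :: 'h::chilbert_space \<Rightarrow> 'h \<Rightarrow> real"
proof
  show "\<exists>K. \<forall>(a::'h) b. norm (rinner a b) \<le> norm a * norm b * K"
    by (intro exI[of _ 1]) (simp add: abs_rinner_le)
qed (simp_all add: rinner_add_left rinner_add_right rinner_scaleR_left rinner_scaleR_right)

lemma norm_add_sq:
  "(norm (\<xi> + \<eta>))\<^sup>2 = (norm \<xi>)\<^sup>2 + 2 * rinner \<xi> \<eta> + (norm (\<eta>::'h::chilbert_space))\<^sup>2"
  by (simp add: rinner_self[symmetric] rinner.add_left rinner.add_right rinner_commute[of \<eta> \<xi>])

lemma norm_diff_sq:
  "(norm (\<xi> - \<eta>))\<^sup>2 = (norm \<xi>)\<^sup>2 - 2 * rinner \<xi> \<eta> + (norm (\<eta>::'h::chilbert_space))\<^sup>2"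
  by (simp add: rinner_self[symmetric] rinner.diff_left rinner.diff_right rinner_commute[of \<eta> \<xi>])

lemma rinner_eqI:
  assumes "\<And>\<zeta>. rinner \<zeta> \<xi> = rinner \<zeta> \<eta>"
  shows "\<xi> = \<eta>"
proof -
  have "rinner (\<xi> - \<eta>) (\<xi> - \<eta>) = 0" by (simp add: assms rinner.diff_right)
  then show ?thesis by (simp add: rinner_self)
qed

section \<open>Representation of functionals, and adjoints\<close>

text \<open>
  The representing vector is the minimizer of \<open>\<parallel>\<xi>\<parallel>\<^sup>2 - 2 f(\<xi>)\<close>: the parallelogram law makes minimizing
  sequences Cauchy, and the first variation at the minimizer vanishes.
\<close>

theorem riesz_rinner:
  fixes f :: "'h::chilbert_space \<Rightarrow> real"
  assumes "bounded_linear f"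
  obtains \<eta> where "\<And>\<xi>. f \<xi> = rinner \<xi> \<eta>"
proof -
  interpret f: bounded_linear f by fact
  define \<phi> where "\<phi> \<xi> = (norm \<xi>)\<^sup>2 - 2 * f \<xi>" for \<xi>
  define m where "m = Inf (range \<phi>)"
  obtain K where K: "\<And>\<xi>. \<bar>f \<xi>\<bar> \<le> norm \<xi> * K" using f.bounded by (auto simp: real_norm_def)
  have "- K\<^sup>2 \<le> \<phi> \<xi>" for \<xi>
  proof -
    have "0 \<le> (norm \<xi> - K)\<^sup>2" by simp
    then show ?thesis using K[of \<xi>] by (simp add: \<phi>_def power2_eq_square algebra_simps)
  qed
  then have bdd: "bdd_below (range \<phi>)" by (intro bdd_belowI[of _ "- K\<^sup>2"]) auto
  have m_le: "m \<le> \<phi> \<xi>" for \<xi> unfolding m_def by (rule cInf_lower[OF _ bdd]) simp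
  have "\<exists>\<xi>. \<phi> \<xi> < m + 1 / Suc n" for n
  proof -
    have "Inf (range \<phi>) < m + 1 / Suc n" by (simp add: m_def)
    then show ?thesis using cInf_less_iff[OF _ bdd] by auto
  qed
  then obtain u where u: "\<And>n. \<phi> (u n) < m + 1 / Suc n" by metis
  have par: "(norm (\<xi> - \<eta>))\<^sup>2 \<le> 2 * (\<phi> \<xi> - m) + 2 * (\<phi> \<eta> - m)" for \<xi> \<eta>
  proof -
    have "(norm (\<xi> - \<eta>))\<^sup>2 = 2 * \<phi> \<xi> + 2 * \<phi> \<eta> - 4 * \<phi> ((1/2) *\<^sub>R (\<xi> + \<eta>))"
      unfolding \<phi>_def norm_diff_sq f.scaleR f.add norm_scaleR power_mult_distrib norm_add_sq
      by (simp add: power2_eq_square field_simps)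
    with m_le[of "(1/2) *\<^sub>R (\<xi> + \<eta>)"] show ?thesis by simp
  qed
  have "Cauchy u"
  proof (rule metric_CauchyI)
    fix e :: real assume e: "0 < e"
    obtain N where N: "4 / Suc N < e\<^sup>2"
      using reals_Archimedean[of "e\<^sup>2 / 4"] e by (auto simp: field_simps)
    show "\<exists>M. \<forall>m\<ge>M. \<forall>n\<ge>M. dist (u m) (u n) < e"
    proof (intro exI allI impI)
      fix i j assume ij: "N \<le> i" "N \<le> j"
      have a: "\<phi> (u k) - m \<le> 1 / Suc N" if "N \<le> k" for k
      proof -
        have "1 / real (Suc k) \<le> 1 / Suc N" using that by (intro divide_left_mono) auto
        with u[of k] show ?thesis by simp
      qed
      have "(norm (u i - u j))\<^sup>2 \<le> 4 / Suc N"
        using par[of "u i" "u j"] a[OF ij(1)] a[OF ij(2)] by simp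
      also have "\<dots> < e\<^sup>2" by (rule N)
      finally show "dist (u i) (u j) < e" using e by (simp add: dist_norm power_less_imp_less_base)
    qed
  qed
  then obtain \<eta> where \<eta>: "u \<longlonglongrightarrow> \<eta>" using Cauchy_convergent convergent_def by blast
  have "(\<lambda>n. \<phi> (u n)) \<longlonglongrightarrow> \<phi> \<eta>"
    unfolding \<phi>_def by (intro tendsto_intros \<eta> f.tendsto)
  moreover have "(\<lambda>n. \<phi> (u n)) \<longlonglongrightarrow> m"
  proof (rule tendsto_sandwich)
    show "\<forall>\<^sub>F n in sequentially. m \<le> \<phi> (u n)" using m_le by simp
    show "\<forall>\<^sub>F n in sequentially. \<phi> (u n) \<le> m + 1 / Suc n"
      using u by (auto intro: less_imp_le always_eventually)
    show "(\<lambda>n. m) \<longlonglongrightarrow> m" by simp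
    show "(\<lambda>n. m + 1 / real (Suc n)) \<longlonglongrightarrow> m"
      using tendsto_add[OF tendsto_const[of m] LIMSEQ_inverse_real_of_nat]
      by (simp add: inverse_eq_divide)
  qed
  ultimately have min: "\<phi> \<eta> \<le> \<phi> \<xi>" for \<xi> using LIMSEQ_unique m_le by metis
  have "f \<xi> = rinner \<xi> \<eta>" for \<xi>
  proof (cases "\<xi> = 0")
    case True
    then show ?thesis by (simp add: f.zero rinner.zero_left)
  next
    case False
    define d where "d = f \<xi> - rinner \<xi> \<eta>"
    define s where "s = d / (norm \<xi>)\<^sup>2"
    have n: "(norm \<xi>)\<^sup>2 > 0" using False by simp
    have "0 \<le> \<phi> (\<eta> + s *\<^sub>R \<xi>) - \<phi> \<eta>" using min by simp
    also have "\<dots> = s * s * (norm \<xi>)\<^sup>2 - 2 * s * d"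
      unfolding \<phi>_def norm_add_sq f.scaleR f.add norm_scaleR power_mult_distrib rinner.scaleR_right
      by (simp add: d_def rinner_commute algebra_simps power2_eq_square)
    also have "\<dots> = - d\<^sup>2 / (norm \<xi>)\<^sup>2"
      using n by (simp add: s_def field_simps power2_eq_square)
    finally have "d\<^sup>2 \<le> 0" using n by (simp add: field_simps)
    then show ?thesis by (simp add: d_def)
  qed
  then show ?thesis by (rule that)
qed

lemma cinner_eq_rinner:
  "cinner \<xi> \<eta> = Complex (rinner \<xi> \<eta>) (- rinner (\<i> *\<^sub>C \<xi>) \<eta>)"
  by (simp add: rinner_def cinner_scaleC_left complex_eq_iff)

text \<open>
  Without existence of adjoints, \<^const>\<open>adj\<close> would be an unspecified choice and the equation
  \<open>adj x = x\<close> would say nothing about \<open>x\<close>.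
\<close>

lemma exists_adjoint:
  fixes T :: "'h::chilbert_space \<Rightarrow>\<^sub>L 'h"
  obtains S :: "'h \<Rightarrow>\<^sub>L 'h" where "\<And>\<xi> \<eta>. rinner (T \<xi>) \<eta> = rinner \<xi> (S \<eta>)"
proof -
  have "\<exists>\<zeta>. \<forall>\<xi>. rinner (T \<xi>) \<eta> = rinner \<xi> \<zeta>" for \<eta>
  proof -
    have "bounded_linear (\<lambda>\<xi>. rinner (T \<xi>) \<eta>)"
      by (intro bounded_linear_compose[OF rinner.bounded_linear_left] blinfun.bounded_linear_right)
    then show ?thesis by (metis riesz_rinner)
  qed
  then obtain g where g: "\<And>\<xi> \<eta>. rinner (T \<xi>) \<eta> = rinner \<xi> (g \<eta>)" by metis
  have "bounded_linear g"
  proof (rule bounded_linear_intro)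
    show "g (a + b) = g a + g b" for a b
      by (rule rinner_eqI) (simp add: g[symmetric] rinner.add_right)
    show "g (c *\<^sub>R a) = c *\<^sub>R g a" for a c
      by (rule rinner_eqI) (simp add: g[symmetric] rinner.scaleR_right)
    show "norm (g \<eta>) \<le> norm \<eta> * norm T" for \<eta>
    proof (cases "g \<eta> = 0")
      case False
      have "norm (g \<eta>) * norm (g \<eta>) = rinner (T (g \<eta>)) \<eta>"
        by (simp add: g rinner_self power2_eq_square)
      also have "\<dots> \<le> norm (T (g \<eta>)) * norm \<eta>" using abs_rinner_le[of "T (g \<eta>)" \<eta>] by linarith
      also have "\<dots> \<le> norm T * norm (g \<eta>) * norm \<eta>" by (intro mult_right_mono norm_blinfun) simp
      finally have "norm (g \<eta>) * norm (g \<eta>) \<le> norm (g \<eta>) * (norm \<eta> * norm T)"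
        by (simp add: mult_ac)
      then show ?thesis using False by simp
    qed (simp add: mult_nonneg_nonneg)
  qed
  then have "rinner (T \<xi>) \<eta> = rinner \<xi> (Blinfun g \<eta>)" for \<xi> \<eta>
    by (simp add: bounded_linear_Blinfun_apply g)
  then show ?thesis by (rule that)
qed

definition selfadjoint :: "('h::chilbert_space \<Rightarrow>\<^sub>L 'h) \<Rightarrow> bool"
  where "selfadjoint T \<longleftrightarrow> (\<forall>\<xi> \<eta>. rinner (T \<xi>) \<eta> = rinner \<xi> (T \<eta>))"

lemma adj_eqI:
  fixes T S :: "'h::chilbert_space \<Rightarrow>\<^sub>L 'h"
  assumes "T \<in> bounded_ops" and S: "\<And>\<xi> \<eta>. rinner (T \<xi>) \<eta> = rinner \<xi> (S \<eta>)"
  shows "adj T = S"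
  unfolding adj_def
proof (rule the_equality)
  have T: "T (c *\<^sub>C \<xi>) = c *\<^sub>C T \<xi>" for c \<xi> using assms(1) by (simp add: bounded_ops_def)
  show "\<forall>\<xi> \<eta>. cinner (T \<xi>) \<eta> = cinner \<xi> (S \<eta>)"
    by (simp add: cinner_eq_rinner S T[symmetric])
  fix R :: "'h \<Rightarrow>\<^sub>L 'h" assume R: "\<forall>\<xi> \<eta>. cinner (T \<xi>) \<eta> = cinner \<xi> (R \<eta>)"
  show "R = S"
  proof (rule blinfun_eqI, rule rinner_eqI)
    fix \<eta> \<zeta>
    have "rinner \<zeta> (R \<eta>) = rinner (T \<zeta>) \<eta>" using R by (simp add: rinner_def)
    then show "rinner \<zeta> (R \<eta>) = rinner \<zeta> (S \<eta>)" by (simp add: S)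
  qed
qed

lemma rinner_adj:
  assumes "T \<in> bounded_ops"
  shows "rinner (T \<xi>) \<eta> = rinner \<xi> (adj T \<eta>)"
  by (metis adj_eqI[OF assms] exists_adjoint)

lemma adj_eq_self_iff: "T \<in> bounded_ops \<Longrightarrow> adj T = T \<longleftrightarrow> selfadjoint T"
  unfolding selfadjoint_def by (metis adj_eqI rinner_adj)

lemma selfadjointD: "selfadjoint T \<Longrightarrow> rinner (T \<xi>) \<eta> = rinner \<xi> (T \<eta>)"
  by (simp add: selfadjoint_def)

text \<open>
  Polarization bounds \<open>\<langle>D \<xi>, \<eta>\<rangle>\<close> by the quadratic form; \<open>\<eta>\<close> is then taken parallel to \<open>D \<xi>\<close> and of
  the same length as \<open>\<xi>\<close>.
\<close>

lemma selfadjoint_norm_bound: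
  fixes D :: "'h::chilbert_space \<Rightarrow>\<^sub>L 'h"
  assumes D: "selfadjoint D" and c: "0 \<le> c" and b: "\<And>\<xi>. \<bar>rinner (D \<xi>) \<xi>\<bar> \<le> c * (norm \<xi>)\<^sup>2"
  shows "norm D \<le> c"
proof (rule norm_blinfun_bound[OF c])
  fix \<xi>
  show "norm (D \<xi>) \<le> c * norm \<xi>"
  proof (cases "D \<xi> = 0 \<or> \<xi> = 0")
    case True
    then show ?thesis using c by auto
  next
    case False
    define \<eta> where "\<eta> = (norm \<xi> / norm (D \<xi>)) *\<^sub>R D \<xi>"
    have ne: "norm \<eta> = norm \<xi>" using False by (simp add: \<eta>_def)
    have "4 * rinner (D \<xi>) \<eta> = rinner (D (\<xi> + \<eta>)) (\<xi> + \<eta>) - rinner (D (\<xi> - \<eta>)) (\<xi> - \<eta>)"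
      using selfadjointD[OF D, of \<xi> \<eta>]
      by (simp add: blinfun.add_right blinfun.diff_right rinner.add_left rinner.add_right
          rinner.diff_left rinner.diff_right rinner_commute[of "D \<eta>" \<xi>])
    also have "\<dots> \<le> c * (norm (\<xi> + \<eta>))\<^sup>2 + c * (norm (\<xi> - \<eta>))\<^sup>2"
      using b[of "\<xi> + \<eta>"] b[of "\<xi> - \<eta>"] by linarith
    also have "\<dots> = 4 * (c * (norm \<xi>)\<^sup>2)" by (simp add: norm_add_sq norm_diff_sq ne rinner_commute[of \<eta> \<xi>] algebra_simps)
    finally have "rinner (D \<xi>) \<eta> \<le> c * (norm \<xi>)\<^sup>2" by simp
    also have "rinner (D \<xi>) \<eta> = norm \<xi> * norm (D \<xi>)"
      using False by (simp add: \<eta>_def rinner.scaleR_right rinner_self power2_eq_square)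
    finally have "norm \<xi> * norm (D \<xi>) \<le> norm \<xi> * (c * norm \<xi>)" by (simp add: power2_eq_square mult_ac)
    then show ?thesis using False by simp
  qed
qed

section \<open>Strong limits\<close>

definition strong_limit :: "('i \<Rightarrow> 'h::chilbert_space \<Rightarrow>\<^sub>L 'h) \<Rightarrow> ('h \<Rightarrow>\<^sub>L 'h) \<Rightarrow> 'i filter \<Rightarrow> bool"
  where "strong_limit T S F \<longleftrightarrow> (\<forall>\<xi>. ((\<lambda>i. T i \<xi>) \<longlongrightarrow> S \<xi>) F)"

lemma strong_limitD: "strong_limit T S F \<Longrightarrow> ((\<lambda>i. T i \<xi>) \<longlongrightarrow> S \<xi>) F"
  by (simp add: strong_limit_def)

lemma limitin_strong_operator_topology:
  "limitin strong_operator_topology T S F \<longleftrightarrow> strong_limit T S F"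
proof
  assume L: "limitin strong_operator_topology T S F"
  show "strong_limit T S F"
    unfolding strong_limit_def
  proof
    fix \<xi>
    have "limitin euclidean ((\<lambda>T. blinfun_apply T \<xi>) \<circ> T) (S \<xi>) F"
      by (rule continuous_map_limit[OF strong_operator_topology_continuous_evaluation L])
    then show "((\<lambda>i. T i \<xi>) \<longlongrightarrow> S \<xi>) F" by (simp add: comp_def)
  qed
next
  assume L: "strong_limit T S F"
  have lf: "((\<lambda>i. blinfun_apply (T i)) \<longlongrightarrow> blinfun_apply S) F"
  proof -
    have "limitin (product_topology (\<lambda>i. euclidean) UNIV) (\<lambda>i. blinfun_apply (T i)) (blinfun_apply S) F"
      using L by (simp add: limitin_componentwise strong_limit_def)
    then show ?thesis by (simp add: euclidean_product_topology)
  qed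
  show "limitin strong_operator_topology T S F"
    unfolding limitin_def
  proof (intro conjI allI impI)
    show "S \<in> topspace strong_operator_topology" by (simp add: strong_operator_topology_topspace)
    fix U assume "openin strong_operator_topology U \<and> S \<in> U"
    then obtain V where V: "open V" "U = blinfun_apply -` V" "blinfun_apply S \<in> V"
      unfolding strong_operator_topology_def openin_pullback_topology by auto
    have "\<forall>\<^sub>F i in F. blinfun_apply (T i) \<in> V" using lf V(1,3) by (rule topological_tendstoD)
    then show "\<forall>\<^sub>F i in F. T i \<in> U" by (simp add: V(2))
  qed
qed

text \<open>
  Multiplication of operators is not jointly continuous in the strong operator topology, but it is
  so on norm bounded sets.
\<close>

lemma tendsto_blinfun_apply_bounded:
  assumes "strong_limit A B F" and "\<forall>\<^sub>F i in F. norm (A i) \<le> C" and "(v \<longlongrightarrow> \<eta>) F"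
  shows "((\<lambda>i. A i (v i)) \<longlongrightarrow> B \<eta>) F"
proof -
  have "((\<lambda>i. A i (v i - \<eta>)) \<longlongrightarrow> 0) F"
  proof (rule Lim_null_comparison)
    show "\<forall>\<^sub>F i in F. norm (A i (v i - \<eta>)) \<le> C * norm (v i - \<eta>)"
      using assms(2)
    proof eventually_elim
      case (elim i)
      then show ?case by (meson norm_blinfun mult_right_mono norm_ge_zero order_trans)
    qed
    show "((\<lambda>i. C * norm (v i - \<eta>)) \<longlongrightarrow> 0) F"
      using tendsto_mult_right_zero[OF tendsto_norm_zero[OF LIM_zero[OF assms(3)]]] .
  qed
  from tendsto_add[OF this strong_limitD[OF assms(1), of \<eta>]] show ?thesis
    by (simp add: blinfun.diff_right)
qed

lemma convergentI_Cauchy_filter: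
  fixes f :: "'i \<Rightarrow> 'b::banach"
  assumes F: "F \<noteq> bot"
    and C: "\<And>e. e > 0 \<Longrightarrow> \<exists>P. eventually P F \<and> (\<forall>i j. P i \<and> P j \<longrightarrow> dist (f i) (f j) < e)"
  obtains l where "(f \<longlongrightarrow> l) F"
proof -
  have "cauchy_filter (filtermap f F)" using C by (simp add: cauchy_filter_metric_filtermap)
  then have "\<exists>l\<in>UNIV. filtermap f F \<le> nhds l"
    using cauchy_filter_complete_converges[of "filtermap f F" UNIV] F
    by (simp add: complete_UNIV filtermap_bot_iff)
  then show ?thesis using that by (auto simp: filterlim_def)
qed

lemma strong_limit_exists:
  fixes T :: "'i \<Rightarrow> 'h::chilbert_space \<Rightarrow>\<^sub>L 'h"
  assumes F: "F \<noteq> bot" and b: "\<forall>\<^sub>F i in F. norm (T i) \<le> C"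
    and c: "\<And>\<xi>. \<exists>\<eta>. ((\<lambda>i. T i \<xi>) \<longlongrightarrow> \<eta>) F"
  obtains S where "strong_limit T S F"
proof -
  obtain g where g: "\<And>\<xi>. ((\<lambda>i. T i \<xi>) \<longlongrightarrow> g \<xi>) F" using c by metis
  have "bounded_linear g"
  proof (rule bounded_linear_intro)
    show "g (a + b) = g a + g b" for a b
      using tendsto_unique[OF F g tendsto_add[OF g g, of a b, folded blinfun.add_right]] by simp
    show "g (r *\<^sub>R a) = r *\<^sub>R g a" for a r
      using tendsto_unique[OF F g tendsto_scaleR[OF tendsto_const g, of r a, folded blinfun.scaleR_right]]
      by simp
    show "norm (g \<xi>) \<le> norm \<xi> * C" for \<xi>
    proof (rule tendsto_upperbound[OF tendsto_norm[OF g] _ F])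
      show "\<forall>\<^sub>F i in F. norm (T i \<xi>) \<le> norm \<xi> * C"
        using b
      proof eventually_elim
        case (elim i)
        then show ?case
          by (metis mult.commute mult_right_mono norm_blinfun norm_ge_zero order_trans)
      qed
    qed
  qed
  then have "strong_limit T (Blinfun g) F" by (simp add: strong_limit_def g bounded_linear_Blinfun_apply)
  then show ?thesis by (rule that)
qed

lemma strong_limit_rinner: "strong_limit T S F \<Longrightarrow> ((\<lambda>i. rinner (T i \<xi>) \<eta>) \<longlongrightarrow> rinner (S \<xi>) \<eta>) F"
  by (intro rinner.tendsto tendsto_const strong_limitD)

lemma strong_limit_selfadjoint:
  assumes F: "F \<noteq> bot" and L: "strong_limit T S F" and ev: "\<forall>\<^sub>F i in F. selfadjoint (T i)"
  shows "selfadjoint S"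
  unfolding selfadjoint_def
proof (intro allI)
  fix \<xi> \<eta>
  have "((\<lambda>i. rinner (T i \<xi>) \<eta>) \<longlongrightarrow> rinner \<xi> (S \<eta>)) F"
  proof (rule Lim_transform_eventually)
    show "((\<lambda>i. rinner \<xi> (T i \<eta>)) \<longlongrightarrow> rinner \<xi> (S \<eta>)) F"
      by (intro rinner.tendsto tendsto_const strong_limitD L)
    show "\<forall>\<^sub>F i in F. rinner \<xi> (T i \<eta>) = rinner (T i \<xi>) \<eta>"
      using ev by eventually_elim (simp add: selfadjointD)
  qed
  then show "rinner (S \<xi>) \<eta> = rinner \<xi> (S \<eta>)" using tendsto_unique[OF F strong_limit_rinner[OF L]] by blast
qed

lemma strong_limit_commute:
  fixes Y :: "'h::chilbert_space \<Rightarrow>\<^sub>L 'h"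
  assumes F: "F \<noteq> bot" and L: "strong_limit T S F" and ev: "\<forall>\<^sub>F i in F. \<forall>\<xi>. T i (Y \<xi>) = Y (T i \<xi>)"
  shows "S (Y \<xi>) = Y (S \<xi>)"
proof -
  have "((\<lambda>i. T i (Y \<xi>)) \<longlongrightarrow> Y (S \<xi>)) F"
  proof (rule Lim_transform_eventually)
    show "((\<lambda>i. Y (T i \<xi>)) \<longlongrightarrow> Y (S \<xi>)) F" by (intro blinfun.tendsto tendsto_const strong_limitD L)
    show "\<forall>\<^sub>F i in F. Y (T i \<xi>) = T i (Y \<xi>)" using ev by eventually_elim simp
  qed
  then show ?thesis using tendsto_unique[OF F strong_limitD[OF L]] by blast
qed

lemma limitin_sot:
  "limitin sot T S F \<longleftrightarrow> S \<in> bounded_ops \<and> (\<forall>\<^sub>F i in F. T i \<in> bounded_ops) \<and> strong_limit T S F"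
  by (simp add: sot_def limitin_subtopology limitin_strong_operator_topology)

lemma strong_limit_bounded_ops:
  fixes S :: "'h::chilbert_space \<Rightarrow>\<^sub>L 'h"
  assumes F: "F \<noteq> bot" and L: "strong_limit T S F" and ev: "\<forall>\<^sub>F i in F. T i \<in> bounded_ops"
  shows "S \<in> bounded_ops"
  unfolding bounded_ops_def
proof (intro CollectI allI)
  fix c and \<xi> :: 'h
  \<comment> \<open>continuity of the complex scalar multiplication, which lets complex linearity pass to the limit\<close>
  have bl: "bounded_linear (\<lambda>\<xi>::'h. c *\<^sub>C \<xi>)"
  proof (rule bounded_linear_intro)
    show "c *\<^sub>C (a + b) = c *\<^sub>C a + c *\<^sub>C (b::'h)" for a b by (rule scaleC_add_right)
    show "c *\<^sub>C (r *\<^sub>R a) = r *\<^sub>R (c *\<^sub>C (a::'h))" for r a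
      by (simp add: scaleR_eq_scaleC scaleC_scaleC mult.commute)
    show "norm (c *\<^sub>C a) \<le> norm (a::'h) * cmod c" for a
    proof -
      have "complex_of_real ((norm (c *\<^sub>C a))\<^sup>2) = c * cnj c * of_real ((norm a)\<^sup>2)"
        by (metis (no_types) cinner_self cinner_scaleC_left cinner_commute complex_cnj_mult
            complex_cnj_complex_of_real mult.assoc mult.commute)
      also have "\<dots> = complex_of_real ((cmod c)\<^sup>2 * (norm a)\<^sup>2)"
        by (simp add: complex_norm_square[symmetric])
      finally have "(norm (c *\<^sub>C a))\<^sup>2 = (norm a * cmod c)\<^sup>2"
        by (metis of_real_eq_iff power_mult_distrib mult.commute)
      then show ?thesis by (simp add: power2_eq_iff_nonneg)
    qed
  qed
  have "((\<lambda>i. T i (c *\<^sub>C \<xi>)) \<longlongrightarrow> c *\<^sub>C S \<xi>) F"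
  proof (rule Lim_transform_eventually)
    show "((\<lambda>i. c *\<^sub>C T i \<xi>) \<longlongrightarrow> c *\<^sub>C S \<xi>) F"
      by (intro bounded_linear.tendsto[OF bl] strong_limitD L)
    show "\<forall>\<^sub>F i in F. c *\<^sub>C T i \<xi> = T i (c *\<^sub>C \<xi>)"
      using ev by eventually_elim (simp add: bounded_ops_def)
  qed
  then show "S (c *\<^sub>C \<xi>) = c *\<^sub>C S \<xi>" using tendsto_unique[OF F strong_limitD[OF L]] by blast
qed

section \<open>Polynomials of a self-adjoint operator\<close>

text \<open>
  The functional calculus for polynomials, as a Horner scheme. Identities between operators that
  are polynomials in one \<open>T\<close> become identities in the commutative ring of polynomials.
\<close>

definition poly_op :: "real poly \<Rightarrow> ('h::chilbert_space \<Rightarrow>\<^sub>L 'h) \<Rightarrow> 'h \<Rightarrow>\<^sub>L 'h"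
  where "poly_op p T = fold_coeffs (\<lambda>a S. a *\<^sub>R id_blinfun + (T o\<^sub>L S)) p 0"

lemma poly_op_0 [simp]: "poly_op 0 T = 0"
  by (simp add: poly_op_def)

lemma poly_op_pCons [simp]: "poly_op (pCons a p) T = a *\<^sub>R id_blinfun + (T o\<^sub>L poly_op p T)"
proof -
  have "T o\<^sub>L 0 = 0" by (rule blinfun_eqI) simp
  then show ?thesis by (cases "p = 0 \<and> a = 0") (auto simp: poly_op_def)
qed

lemma poly_op_1 [simp]: "poly_op 1 T = id_blinfun"
  by (rule blinfun_eqI) (simp add: one_pCons blinfun.bilinear_simps)

lemma poly_op_add: "poly_op (p + q) T = poly_op p T + poly_op q T"
  by (induction p q rule: poly_induct2)
    (auto intro!: blinfun_eqI simp: blinfun.bilinear_simps scaleR_add_left)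

lemma poly_op_smult: "poly_op (smult c p) T = c *\<^sub>R poly_op p T"
  by (induction p) (auto intro!: blinfun_eqI simp: blinfun.bilinear_simps scaleR_add_right)

lemma poly_op_minus: "poly_op (- p) T = - poly_op p T"
  using poly_op_smult[of "-1" p T] by simp

lemma poly_op_diff: "poly_op (p - q) T = poly_op p T - poly_op q T"
  using poly_op_add[of p "- q" T] by (simp add: poly_op_minus)

lemma poly_op_mult: "poly_op (p * q) T = poly_op p T o\<^sub>L poly_op q T"
proof (induction p)
  case 0
  show ?case by (auto intro!: blinfun_eqI)
next
  case (pCons a p)
  have "poly_op (pCons a p * q) T = a *\<^sub>R poly_op q T + (T o\<^sub>L (poly_op p T o\<^sub>L poly_op q T))"
    by (simp add: poly_op_add poly_op_smult pCons.IH)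
  also have "\<dots> = poly_op (pCons a p) T o\<^sub>L poly_op q T"
    by (auto intro!: blinfun_eqI simp: blinfun.bilinear_simps)
  finally show ?case .
qed

lemma poly_op_mult_apply: "poly_op (p * q) T \<xi> = poly_op p T (poly_op q T \<xi>)"
  by (simp add: poly_op_mult)

lemma poly_op_swap: "poly_op p T (poly_op q T \<xi>) = poly_op q T (poly_op p T \<xi>)"
  by (metis mult.commute poly_op_mult_apply)

lemma selfadjoint_poly_op:
  assumes T: "selfadjoint T"
  shows "selfadjoint (poly_op p T)"
proof (induction p)
  case 0
  show ?case by (simp add: selfadjoint_def rinner.zero_left rinner.zero_right)
next
  case (pCons a p)
  have c: "T (poly_op p T \<xi>) = poly_op p T (T \<xi>)" for \<xi>
    using poly_op_swap[of "[:0, 1:]" T p \<xi>] by (simp add: blinfun.bilinear_simps)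
  show ?case
    unfolding selfadjoint_def
  proof (intro allI)
    fix \<xi> \<eta>
    have "rinner (T (poly_op p T \<xi>)) \<eta> = rinner \<xi> (T (poly_op p T \<eta>))"
      by (simp add: selfadjointD[OF T] selfadjointD[OF pCons.IH] c)
    then show "rinner (poly_op (pCons a p) T \<xi>) \<eta> = rinner \<xi> (poly_op (pCons a p) T \<eta>)"
      by (simp add: blinfun.bilinear_simps rinner.add_left rinner.add_right
          rinner.scaleR_left rinner.scaleR_right)
  qed
qed

lemma poly_op_commute:
  fixes T Y :: "'h::chilbert_space \<Rightarrow>\<^sub>L 'h"
  assumes "\<And>\<xi>. T (Y \<xi>) = Y (T \<xi>)"
  shows "poly_op p T (Y \<xi>) = Y (poly_op p T \<xi>)"
  by (induction p arbitrary: \<xi>) (simp_all add: blinfun.bilinear_simps assms)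

section \<open>Positivity of polynomials of an operator\<close>

definition pos_at :: "('h::chilbert_space \<Rightarrow>\<^sub>L 'h) \<Rightarrow> real poly \<Rightarrow> bool"
  where "pos_at T p \<longleftrightarrow> (\<forall>\<xi>. 0 \<le> rinner (poly_op p T \<xi>) \<xi>)"

lemma pos_at_add: "pos_at T p \<Longrightarrow> pos_at T q \<Longrightarrow> pos_at T (p + q)"
  by (simp add: pos_at_def poly_op_add blinfun.add_left rinner.add_left)

lemma pos_at_smult: "0 \<le> c \<Longrightarrow> pos_at T p \<Longrightarrow> pos_at T (smult c p)"
  by (simp add: pos_at_def poly_op_smult blinfun.scaleR_left rinner.scaleR_left)

lemma pos_at_const: "0 \<le> c \<Longrightarrow> pos_at T [:c:]"
  by (simp add: pos_at_def blinfun.bilinear_simps rinner.scaleR_left rinner_self)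

lemma rinner_poly_op_sq:
  assumes "selfadjoint T"
  shows "rinner (poly_op (p * q * p) T \<xi>) \<xi> = rinner (poly_op q T (poly_op p T \<xi>)) (poly_op p T \<xi>)"
  by (simp add: poly_op_mult_apply selfadjointD[OF selfadjoint_poly_op[OF assms]])

lemma rinner_poly_op_square:
  "selfadjoint T \<Longrightarrow> rinner (poly_op (p * p) T \<xi>) \<xi> = (norm (poly_op p T \<xi>))\<^sup>2"
  by (simp add: poly_op_mult_apply rinner_self[symmetric]
      selfadjointD[OF selfadjoint_poly_op, of T p "poly_op p T \<xi>"])

lemma pos_at_sandwich: "selfadjoint T \<Longrightarrow> pos_at T q \<Longrightarrow> pos_at T (p * q * p)"
  by (simp add: pos_at_def rinner_poly_op_sq)

lemma pos_at_square: "selfadjoint T \<Longrightarrow> pos_at T (p * p)"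
  by (simp add: pos_at_def rinner_poly_op_square)

text \<open>
  The argument of F. Riesz for products of commuting positive operators. For \<open>0 \<le> q \<le> 1\<close> the
  recursion \<open>b \<mapsto> b - b\<^sup>2\<close> started at \<open>q\<close> stays between \<open>0\<close> and \<open>1\<close> and writes \<open>q\<close> as a sum of
  squares \<open>b\<^sub>k\<^sup>2\<close> plus a remainder that tends strongly to \<open>0\<close>. In \<open>p q\<close> each square contributes the
  positive operator \<open>b\<^sub>k p b\<^sub>k\<close>.
\<close>

lemma pos_at_mult_unit:
  assumes T: "selfadjoint T" and p: "pos_at T p" and q: "pos_at T q" and q1: "pos_at T (1 - q)"
  shows "pos_at T (p * q)"
proof -
  define b where "b = rec_nat q (\<lambda>_ a. a - a * a)"
  have b0: "b 0 = q" and bS: "\<And>n. b (Suc n) = b n - b n * b n" by (simp_all add: b_def)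
  have b: "pos_at T (b n) \<and> pos_at T (1 - b n)" for n
  proof (induction n)
    case 0
    show ?case using q q1 by (simp add: b0)
  next
    case (Suc n)
    have "b (Suc n) = b n * (1 - b n) * b n + (1 - b n) * b n * (1 - b n)"
      by (simp add: bS algebra_simps)
    moreover have "1 - b (Suc n) = (1 - b n) + b n * b n" by (simp add: bS)
    ultimately show ?case
      using Suc by (metis T pos_at_add pos_at_sandwich pos_at_square)
  qed
  have q_eq: "q = (\<Sum>k<n. b k * b k) + b n" for n
    by (induction n) (simp_all add: b0 bS algebra_simps)
  have sum_apply: "rinner (poly_op (\<Sum>k<n. f k) T \<xi>) \<xi> = (\<Sum>k<n. rinner (poly_op (f k) T \<xi>) \<xi>)"
    for f :: "nat \<Rightarrow> real poly" and n :: nat and \<xi>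
    by (induction n) (simp_all add: poly_op_add blinfun.add_left rinner.add_left rinner.zero_left)
  show ?thesis
    unfolding pos_at_def
  proof
    fix \<xi>
    have "(\<Sum>k<n. (norm (poly_op (b k) T \<xi>))\<^sup>2) \<le> rinner (poly_op q T \<xi>) \<xi>" for n
    proof -
      have "rinner (poly_op q T \<xi>) \<xi>
          = (\<Sum>k<n. (norm (poly_op (b k) T \<xi>))\<^sup>2) + rinner (poly_op (b n) T \<xi>) \<xi>"
        by (subst q_eq[of n])
          (simp add: poly_op_add blinfun.add_left rinner.add_left sum_apply rinner_poly_op_square[OF T])
      moreover have "0 \<le> rinner (poly_op (b n) T \<xi>) \<xi>" using b[of n] by (simp add: pos_at_def)
      ultimately show ?thesis by simp
    qed
    then have "summable (\<lambda>k. (norm (poly_op (b k) T \<xi>))\<^sup>2)"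
      by (intro summableI_nonneg_bounded) simp_all
    then have "(\<lambda>k. (norm (poly_op (b k) T \<xi>))\<^sup>2) \<longlonglongrightarrow> 0" by (rule summable_LIMSEQ_zero)
    then have "(\<lambda>k. sqrt ((norm (poly_op (b k) T \<xi>))\<^sup>2)) \<longlonglongrightarrow> sqrt 0" by (rule tendsto_real_sqrt)
    then have b_lim: "(\<lambda>k. poly_op (b k) T \<xi>) \<longlonglongrightarrow> 0" by (simp add: tendsto_norm_zero_iff)
    have "rinner (poly_op p T (poly_op (b n) T \<xi>)) \<xi> \<le> rinner (poly_op (p * q) T \<xi>) \<xi>" for n
    proof -
      have "p * q = (\<Sum>k<n. b k * p * b k) + p * b n"
        by (subst q_eq[of n]) (simp add: distrib_left sum_distrib_left mult_ac)
      then have "rinner (poly_op (p * q) T \<xi>) \<xi>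
          = (\<Sum>k<n. rinner (poly_op (b k * p * b k) T \<xi>) \<xi>) + rinner (poly_op (p * b n) T \<xi>) \<xi>"
        by (simp add: poly_op_add blinfun.add_left rinner.add_left sum_apply)
      moreover have "0 \<le> (\<Sum>k<n. rinner (poly_op (b k * p * b k) T \<xi>) \<xi>)"
        using pos_at_sandwich[OF T p] by (intro sum_nonneg) (simp add: pos_at_def)
      ultimately show ?thesis by (simp add: poly_op_mult_apply)
    qed
    moreover have "(\<lambda>n. rinner (poly_op p T (poly_op (b n) T \<xi>)) \<xi>) \<longlonglongrightarrow> rinner (poly_op p T 0) \<xi>"
      by (intro rinner.tendsto blinfun.tendsto tendsto_const b_lim)
    ultimately show "0 \<le> rinner (poly_op (p * q) T \<xi>) \<xi>"
      by (intro LIMSEQ_le_const2[where X = "\<lambda>n. rinner (poly_op p T (poly_op (b n) T \<xi>)) \<xi>"]) (auto simp: rinner.zero_left)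
  qed
qed

lemma pos_at_mult:
  assumes T: "selfadjoint T" and p: "pos_at T p" and q: "pos_at T q"
  shows "pos_at T (p * q)"
proof -
  \<comment> \<open>a positive number with \<open>q(T) / c \<le> 1\<close>\<close>
  define c where "c = norm (poly_op q T) + 1"
  have c: "c > 0" by (simp add: c_def add_nonneg_pos)
  have "pos_at T (1 - smult (1/c) q)"
    unfolding pos_at_def
  proof
    fix \<xi>
    have "rinner (poly_op q T \<xi>) \<xi> \<le> norm (poly_op q T \<xi>) * norm \<xi>"
      using abs_rinner_le by (metis abs_le_D1)
    also have "\<dots> \<le> norm (poly_op q T) * norm \<xi> * norm \<xi>" by (intro mult_right_mono norm_blinfun) simp
    also have "\<dots> \<le> c * (norm \<xi>)\<^sup>2" by (simp add: c_def power2_eq_square algebra_simps)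
    finally show "0 \<le> rinner (poly_op (1 - smult (1/c) q) T \<xi>) \<xi>"
      using c by (simp add: poly_op_diff poly_op_smult blinfun.bilinear_simps rinner.diff_left
          rinner.scaleR_left rinner_self field_simps)
  qed
  moreover have "pos_at T (smult (1/c) q)" using c q by (intro pos_at_smult) simp_all
  ultimately have "pos_at T (p * smult (1/c) q)" by (intro pos_at_mult_unit T p)
  then have "pos_at T (smult c (p * smult (1/c) q))" using c by (intro pos_at_smult) simp_all
  then show ?thesis using c by simp
qed

section \<open>The sign of a self-adjoint contraction\<close>

text \<open>
  The Newton--Schulz iteration \<open>t \<mapsto> (3 t - t\<^sup>3) / 2\<close>, which converges to the sign of \<open>t\<close> for
  \<open>-1 \<le> t \<le> 1\<close>. All its iterates vanish at \<open>0\<close>.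
\<close>

definition sign_poly :: "nat \<Rightarrow> real poly"
  where "sign_poly = rec_nat [:0, 1:] (\<lambda>_ p. smult (1/2) (p * ([:3:] - p * p)))"

lemma sign_poly_0: "sign_poly 0 = [:0, 1:]"
  and sign_poly_Suc:
    "sign_poly (Suc n) = smult (1/2) (sign_poly n * ([:3:] - sign_poly n * sign_poly n))"
  by (simp_all add: sign_poly_def)

lemma pos_at_const_plus:
  assumes "pos_at T (1 - p)" "1 \<le> c"
  shows "pos_at T ([:c:] - p)"
proof -
  have eq: "[:c:] - p = [:c - 1:] + (1 - p)" by (simp add: one_pCons)
  show ?thesis unfolding eq using assms(2) by (intro pos_at_add assms(1) pos_at_const) simp
qed

text \<open>
  With \<open>u = t\<^sup>2\<close>, one step of the iteration sends \<open>1 - u\<close> to \<open>(1 - u)\<^sup>2 (4 - u) / 4\<close>.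
\<close>

lemma sign_poly_le_one:
  assumes T: "selfadjoint T" and T1: "norm T \<le> 1"
  shows "pos_at T (1 - sign_poly n * sign_poly n)"
proof (induction n)
  case 0
  have "norm (T \<xi>) \<le> norm \<xi>" for \<xi>
    using norm_blinfun[of T \<xi>] mult_right_mono[OF T1 norm_ge_zero[of \<xi>]] by simp
  then show ?case
    unfolding pos_at_def sign_poly_0 poly_op_diff blinfun.diff_left rinner.diff_left
      rinner_poly_op_square[OF T]
    by (simp add: rinner_self blinfun.bilinear_simps)
next
  case (Suc n)
  define u where "u = sign_poly n * sign_poly n"
  have u: "pos_at T (1 - u)" using Suc by (simp add: u_def)
  have "sign_poly (Suc n) * sign_poly (Suc n) = smult (1/4) (u * (([:3:] - u) * ([:3:] - u)))"
    by (simp add: sign_poly_Suc u_def mult_ac)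
  then have "1 - sign_poly (Suc n) * sign_poly (Suc n)
      = smult (1/4) ([:4:] - u * (([:3:] - u) * ([:3:] - u)))"
    by (simp add: smult_diff_right one_pCons)
  also have "[:4:] - u * (([:3:] - u) * ([:3:] - u)) = (1 - u) * ([:4:] - u) * (1 - u)"
  proof -
    have n: "[:3:] = (3 :: real poly)" "[:4:] = (4 :: real poly)"
      by (simp_all add: numeral_poly)
    show ?thesis unfolding n by (simp add: algebra_simps)
  qed
  finally show ?case
    using pos_at_smult[of "1/4" T, OF _ pos_at_sandwich[OF T pos_at_const_plus[OF u, of 4]]] by simp
qed

lemma sign_poly_increment: "sign_poly (Suc n) - sign_poly n
    = smult (1/2) (sign_poly n * (1 - sign_poly n * sign_poly n))"
proof -
  have n: "[:3:] = (3 :: real poly)" by (simp add: numeral_poly)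
  have h: "smult (1/2) (2 * p) = p" for p :: "real poly"
    by (simp add: numeral_poly)
  have "sign_poly (Suc n) - sign_poly n
      = smult (1/2) (sign_poly n * ([:3:] - sign_poly n * sign_poly n)) - smult (1/2) (2 * sign_poly n)"
    unfolding h sign_poly_Suc ..
  also have "\<dots> = smult (1/2) (sign_poly n * ([:3:] - sign_poly n * sign_poly n) - 2 * sign_poly n)"
    by (simp only: smult_diff_right)
  also have "sign_poly n * ([:3:] - sign_poly n * sign_poly n) - 2 * sign_poly n
      = sign_poly n * (1 - sign_poly n * sign_poly n)"
    unfolding n by (simp add: algebra_simps)
  finally show ?thesis .
qed

text \<open>
  Each step multiplies by \<open>1 + (1 - u) / 2\<close>, so later iterates have the sign of the
  earlier ones and are larger in modulus.
\<close>

lemma sign_poly_mult_mono: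
  assumes T: "selfadjoint T" and T1: "norm T \<le> 1"
  shows "pos_at T (sign_poly n * sign_poly (n + k) - sign_poly n * sign_poly n)"
proof (induction k)
  case 0
  show ?case using pos_at_const[of 0 T] by simp
next
  case (Suc k)
  have "pos_at T (sign_poly n * sign_poly (n + k))"
    using pos_at_add[OF Suc pos_at_square[OF T, of "sign_poly n"]] by simp
  then have a: "pos_at T (smult (1/2) (sign_poly n * sign_poly (n + k) *
      (1 - sign_poly (n + k) * sign_poly (n + k))))"
    by (intro pos_at_smult pos_at_mult[of T "sign_poly n * sign_poly (n + k)"] T sign_poly_le_one T1)
      simp_all
  have "sign_poly n * sign_poly (n + Suc k) - sign_poly n * sign_poly n
    = (sign_poly n * sign_poly (n + k) - sign_poly n * sign_poly n)
      + sign_poly n * (sign_poly (Suc (n + k)) - sign_poly (n + k))"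
    by (simp add: algebra_simps)
  also have "\<dots> = (sign_poly n * sign_poly (n + k) - sign_poly n * sign_poly n)
      + smult (1/2) (sign_poly n * sign_poly (n + k) * (1 - sign_poly (n + k) * sign_poly (n + k)))"
    unfolding sign_poly_increment by (simp add: mult_ac)
  finally show ?case using pos_at_add[OF Suc a] by (simp only:)
qed

lemma norm_sign_poly:
  assumes T: "selfadjoint T" and T1: "norm T \<le> 1"
  shows "norm (poly_op (sign_poly n) T \<xi>) \<le> norm \<xi>"
proof -
  have "0 \<le> (norm \<xi>)\<^sup>2 - (norm (poly_op (sign_poly n) T \<xi>))\<^sup>2"
    using sign_poly_le_one[OF T T1, of n]
    by (simp add: pos_at_def poly_op_diff blinfun.diff_left rinner.diff_left rinner_self
        rinner_poly_op_square[OF T])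
  then show ?thesis by (simp add: abs_le_square_iff)
qed

text \<open>
  Since \<open>p\<^sub>n p\<^sub>m \<ge> p\<^sub>n\<^sup>2\<close> for \<open>n \<le> m\<close>, also \<open>(p\<^sub>m - p\<^sub>n)\<^sup>2 \<le> p\<^sub>m\<^sup>2 - p\<^sub>n\<^sup>2\<close>. So the iterates are
  Cauchy at every vector: their squared norms there increase and are bounded.
\<close>

lemma norm_sign_poly_diff:
  assumes T: "selfadjoint T" and T1: "norm T \<le> 1" and nm: "n \<le> m"
  shows "(norm (poly_op (sign_poly m) T \<xi> - poly_op (sign_poly n) T \<xi>))\<^sup>2
    \<le> (norm (poly_op (sign_poly m) T \<xi>))\<^sup>2 - (norm (poly_op (sign_poly n) T \<xi>))\<^sup>2"
proof -
  obtain k where k: "m = n + k" using nm le_Suc_ex by blast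
  let ?a = "poly_op (sign_poly n) T \<xi>" and ?b = "poly_op (sign_poly m) T \<xi>"
  have "0 \<le> rinner (poly_op (sign_poly n) T ?b) \<xi> - (norm ?a)\<^sup>2"
    using sign_poly_mult_mono[OF T T1, of n k]
    by (simp add: pos_at_def poly_op_diff blinfun.diff_left rinner.diff_left
        rinner_poly_op_square[OF T] k poly_op_mult_apply[of "sign_poly n" "sign_poly (n + k)"])
  then have "(norm ?a)\<^sup>2 \<le> rinner ?b ?a"
    by (simp add: selfadjointD[OF selfadjoint_poly_op[OF T]])
  then show ?thesis by (simp add: norm_diff_sq)
qed

text \<open>
  The equation \<open>S\<^sup>3 = S\<close> says that \<open>S\<close> is the difference of two orthogonal projections. The last
  inequality, \<open>T S \<ge> T\<^sup>2\<close>, implies that \<open>T\<close> is positive on the range of the first, negative on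
  the range of the second, and zero where \<open>S\<close> is zero.
\<close>

theorem sign_operator:
  assumes T: "selfadjoint T" and T1: "norm T \<le> 1"
  obtains S where "strong_limit (\<lambda>n. poly_op (sign_poly n) T) S sequentially"
    and "selfadjoint S" and "\<And>\<xi>. S (S (S \<xi>)) = S \<xi>"
    and "\<And>\<xi>. (norm (T \<xi>))\<^sup>2 \<le> rinner (T (S \<xi>)) \<xi>"
proof -
  let ?T = "\<lambda>n. poly_op (sign_poly n) T"
  have bound: "norm (?T n) \<le> 1" for n
    by (rule norm_blinfun_bound) (simp_all add: norm_sign_poly[OF T T1])
  have conv: "\<exists>\<eta>. (\<lambda>n. ?T n \<xi>) \<longlonglongrightarrow> \<eta>" for \<xi>
  proof -
    define a where "a n = (norm (?T n \<xi>))\<^sup>2" for n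
    have mono: "a n \<le> a m" if "n \<le> m" for n m
      using order_trans[OF zero_le_power2 norm_sign_poly_diff[OF T T1 that, of \<xi>]] by (simp add: a_def)
    have "a n \<le> (norm \<xi>)\<^sup>2" for n
      unfolding a_def by (intro power_mono norm_sign_poly[OF T T1]) simp
    moreover have "incseq a" by (simp add: incseq_def mono)
    ultimately obtain L where "a \<longlonglongrightarrow> L" using incseq_convergent[of a] by blast
    then have "Cauchy a" by (rule LIMSEQ_imp_Cauchy)
    have "Cauchy (\<lambda>n. ?T n \<xi>)"
    proof (rule metric_CauchyI)
      fix e :: real assume e: "0 < e"
      then obtain N where N: "\<And>m n. m \<ge> N \<Longrightarrow> n \<ge> N \<Longrightarrow> dist (a m) (a n) < e\<^sup>2"
        using metric_CauchyD[OF \<open>Cauchy a\<close>, of "e\<^sup>2"] by auto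
      have key: "dist (?T m \<xi>) (?T n \<xi>) < e" if "N \<le> n" "n \<le> m" for m n
      proof -
        have "(norm (?T m \<xi> - ?T n \<xi>))\<^sup>2 \<le> a m - a n"
          using norm_sign_poly_diff[OF T T1 that(2)] by (simp add: a_def)
        also have "\<dots> < e\<^sup>2" using N[of m n] that by (simp add: dist_real_def)
        finally show ?thesis using e by (simp add: dist_norm power_less_imp_less_base)
      qed
      then show "\<exists>N. \<forall>m\<ge>N. \<forall>n\<ge>N. dist (?T m \<xi>) (?T n \<xi>) < e"
        by (metis dist_commute nle_le)
    qed
    then show ?thesis using Cauchy_convergent convergent_def by blast
  qed
  obtain S where S: "strong_limit ?T S sequentially"
    by (rule strong_limit_exists[of sequentially ?T 1]) (simp_all add: bound conv)
  have saS: "selfadjoint S"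
    by (rule strong_limit_selfadjoint[OF _ S]) (simp_all add: selfadjoint_poly_op[OF T])
  have SSS: "S (S (S \<xi>)) = S \<xi>" for \<xi>
  proof -
    have ap: "(\<lambda>n. ?T n (v n)) \<longlonglongrightarrow> S \<eta>" if "v \<longlonglongrightarrow> \<eta>" for v \<eta>
      by (rule tendsto_blinfun_apply_bounded[OF S _ that, of 1]) (simp add: bound)
    have s1: "(\<lambda>n. ?T n \<xi>) \<longlonglongrightarrow> S \<xi>" by (rule strong_limitD[OF S])
    have s3: "(\<lambda>n. ?T n (?T n (?T n \<xi>))) \<longlonglongrightarrow> S (S (S \<xi>))" by (intro ap s1)
    have "(\<lambda>n. ?T (Suc n) \<xi>) \<longlonglongrightarrow> (1/2) *\<^sub>R (3 *\<^sub>R S \<xi> - S (S (S \<xi>)))"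
    proof (rule Lim_transform_eventually)
      show "(\<lambda>n. (1/2) *\<^sub>R (3 *\<^sub>R ?T n \<xi> - ?T n (?T n (?T n \<xi>))))
          \<longlonglongrightarrow> (1/2) *\<^sub>R (3 *\<^sub>R S \<xi> - S (S (S \<xi>)))"
        by (intro tendsto_intros s1 s3)
      have "?T (Suc n) \<xi> = (1/2) *\<^sub>R (3 *\<^sub>R ?T n \<xi> - ?T n (?T n (?T n \<xi>)))" for n
        by (simp add: sign_poly_Suc poly_op_smult poly_op_mult poly_op_diff blinfun.bilinear_simps)
      then show "\<forall>\<^sub>F n in sequentially. (1/2) *\<^sub>R (3 *\<^sub>R ?T n \<xi> - ?T n (?T n (?T n \<xi>))) = ?T (Suc n) \<xi>"
        by simp
    qed
    then have eq: "S \<xi> = (1/2) *\<^sub>R (3 *\<^sub>R S \<xi> - S (S (S \<xi>)))"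
      by (rule LIMSEQ_unique[OF LIMSEQ_Suc[OF s1]])
    have "2 *\<^sub>R S \<xi> = 3 *\<^sub>R S \<xi> - S (S (S \<xi>))"
      using arg_cong[OF eq, of "\<lambda>v. 2 *\<^sub>R v"] by simp
    then have "S (S (S \<xi>)) = 3 *\<^sub>R S \<xi> - 2 *\<^sub>R S \<xi>" by (simp add: algebra_simps)
    also have "\<dots> = S \<xi>" by (simp add: scaleR_left_diff_distrib[symmetric])
    finally show ?thesis .
  qed
  have TS: "(norm (T \<xi>))\<^sup>2 \<le> rinner (T (S \<xi>)) \<xi>" for \<xi>
  proof (rule LIMSEQ_le_const)
    show "(\<lambda>n. rinner (T (?T n \<xi>)) \<xi>) \<longlonglongrightarrow> rinner (T (S \<xi>)) \<xi>"
      by (intro rinner.tendsto blinfun.tendsto tendsto_const strong_limitD[OF S])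
    have "(norm (T \<xi>))\<^sup>2 \<le> rinner (T (?T n \<xi>)) \<xi>" for n
    proof -
      have T0: "poly_op (sign_poly 0) T = T"
        by (rule blinfun_eqI) (simp add: sign_poly_0 blinfun.bilinear_simps)
      have "0 \<le> rinner (poly_op (sign_poly 0) T (?T n \<xi>)) \<xi> - (norm (poly_op (sign_poly 0) T \<xi>))\<^sup>2"
        using sign_poly_mult_mono[OF T T1, of 0 n]
        by (simp add: pos_at_def poly_op_diff blinfun.diff_left rinner.diff_left
            rinner_poly_op_square[OF T] poly_op_mult_apply[of "sign_poly 0" "sign_poly n"])
      then show ?thesis unfolding T0 by simp
    qed
    then show "\<exists>N. \<forall>n\<ge>N. (norm (T \<xi>))\<^sup>2 \<le> rinner (T (?T n \<xi>)) \<xi>" by blast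
  qed
  show ?thesis by (rule that[OF S saS SSS TS])
qed

section \<open>Orthogonal projections\<close>

definition orth_proj :: "('h::chilbert_space \<Rightarrow>\<^sub>L 'h) \<Rightarrow> bool"
  where "orth_proj P \<longleftrightarrow> selfadjoint P \<and> (\<forall>\<xi>. P (P \<xi>) = P \<xi>)"

text \<open>
  Inclusion of ranges; on projections this is the operator order.
\<close>

definition proj_le :: "('h::chilbert_space \<Rightarrow>\<^sub>L 'h) \<Rightarrow> ('h \<Rightarrow>\<^sub>L 'h) \<Rightarrow> bool"
  where "proj_le P Q \<longleftrightarrow> (\<forall>\<xi>. Q (P \<xi>) = P \<xi>)"

lemma orth_proj_idem: "orth_proj P \<Longrightarrow> P (P \<xi>) = P \<xi>"
  by (simp add: orth_proj_def)

lemma orth_proj_sa: "orth_proj P \<Longrightarrow> selfadjoint P"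
  by (simp add: orth_proj_def)

lemma rinner_orth_proj: "orth_proj P \<Longrightarrow> rinner (P \<xi>) \<xi> = (norm (P \<xi>))\<^sup>2"
  by (metis orth_proj_def rinner_self selfadjointD)

lemma norm_orth_proj_le: "orth_proj P \<Longrightarrow> norm (P \<xi>) \<le> norm \<xi>"
proof -
  assume P: "orth_proj P"
  have "0 \<le> (norm (\<xi> - P \<xi>))\<^sup>2" by simp
  also have "\<dots> = (norm \<xi>)\<^sup>2 - (norm (P \<xi>))\<^sup>2"
    by (simp add: norm_diff_sq rinner_commute[of \<xi>] rinner_orth_proj[OF P])
  finally show ?thesis by (simp add: abs_le_square_iff)
qed

lemma norm_orth_proj: "orth_proj P \<Longrightarrow> norm P \<le> 1"
  by (rule norm_blinfun_bound) (simp_all add: norm_orth_proj_le)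

text \<open>
  Taking adjoints in \<open>A B = C\<close>.
\<close>

lemma selfadjoint_commute_flip:
  assumes "selfadjoint A" "selfadjoint B" "selfadjoint C" "\<And>\<xi>. A (B \<xi>) = C \<xi>"
  shows "B (A \<xi>) = C \<xi>"
proof (rule rinner_eqI)
  fix \<zeta>
  have "rinner \<zeta> (B (A \<xi>)) = rinner (A (B \<zeta>)) \<xi>" by (simp add: selfadjointD[OF assms(1)] selfadjointD[OF assms(2)])
  then show "rinner \<zeta> (B (A \<xi>)) = rinner \<zeta> (C \<xi>)" by (simp add: assms(4) selfadjointD[OF assms(3)])
qed

lemma proj_leD:
  assumes "orth_proj P" "orth_proj Q" "proj_le P Q"
  shows "Q (P \<xi>) = P \<xi>" "P (Q \<xi>) = P \<xi>"
  using assms selfadjoint_commute_flip[of Q P P \<xi>] by (auto simp: proj_le_def orth_proj_def)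

lemma proj_leI:
  assumes "orth_proj P" "orth_proj Q" "\<And>\<xi>. P (Q \<xi>) = P \<xi>"
  shows "proj_le P Q"
  using assms selfadjoint_commute_flip[of P Q P] by (auto simp: proj_le_def orth_proj_def)

lemma proj_le_iff_rinner:
  assumes P: "orth_proj P" and Q: "orth_proj Q"
  shows "proj_le P Q \<longleftrightarrow> (\<forall>\<xi>. rinner (P \<xi>) \<xi> \<le> rinner (Q \<xi>) \<xi>)"
proof
  assume le: "proj_le P Q"
  show "\<forall>\<xi>. rinner (P \<xi>) \<xi> \<le> rinner (Q \<xi>) \<xi>"
  proof
    fix \<xi>
    have "norm (P \<xi>) \<le> norm (Q \<xi>)" using norm_orth_proj_le[OF P, of "Q \<xi>"] by (simp add: proj_leD[OF P Q le])
    then show "rinner (P \<xi>) \<xi> \<le> rinner (Q \<xi>) \<xi>" by (simp add: rinner_orth_proj P Q)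
  qed
next
  assume le: "\<forall>\<xi>. rinner (P \<xi>) \<xi> \<le> rinner (Q \<xi>) \<xi>"
  show "proj_le P Q"
    unfolding proj_le_def
  proof
    fix \<xi>
    let ?\<eta> = "P \<xi>"
    have "(norm ?\<eta>)\<^sup>2 \<le> (norm (Q ?\<eta>))\<^sup>2"
      using le[rule_format, of ?\<eta>] by (simp add: rinner_orth_proj P Q orth_proj_idem rinner_self)
    then have "(norm (?\<eta> - Q ?\<eta>))\<^sup>2 \<le> 0"
      by (simp add: norm_diff_sq rinner_commute[of ?\<eta>] rinner_orth_proj[OF Q])
    then show "Q ?\<eta> = ?\<eta>" by simp
  qed
qed

lemma proj_le_refl: "orth_proj P \<Longrightarrow> proj_le P P"
  by (simp add: proj_le_def orth_proj_idem)

lemma proj_le_trans: "proj_le P Q \<Longrightarrow> proj_le Q R \<Longrightarrow> proj_le P R"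
  unfolding proj_le_def by metis

lemma proj_le_antisym: "orth_proj P \<Longrightarrow> orth_proj Q \<Longrightarrow> proj_le P Q \<Longrightarrow> proj_le Q P \<Longrightarrow> P = Q"
  by (rule blinfun_eqI) (metis proj_leD(1) proj_leD(2))

lemma norm_proj_diff:
  assumes "orth_proj P" "orth_proj Q" "proj_le P Q"
  shows "(norm (Q \<xi> - P \<xi>))\<^sup>2 = (norm (Q \<xi>))\<^sup>2 - (norm (P \<xi>))\<^sup>2"
proof -
  have "rinner (Q \<xi>) (P \<xi>) = (norm (P \<xi>))\<^sup>2"
    by (metis assms orth_proj_sa proj_leD(1) rinner_commute rinner_orth_proj selfadjointD)
  then show ?thesis by (simp add: norm_diff_sq)
qed

lemma orth_proj_diff:
  assumes "orth_proj P" "orth_proj Q" "proj_le P Q"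
  shows "orth_proj (Q - P)"
  using assms unfolding orth_proj_def selfadjoint_def
  by (simp add: blinfun.bilinear_simps rinner.diff_left rinner.diff_right proj_leD[OF assms])

lemma strong_limit_orth_proj:
  assumes F: "F \<noteq> bot" and L: "strong_limit P Q F" and ev: "\<forall>\<^sub>F i in F. orth_proj (P i)"
  shows "orth_proj Q"
  unfolding orth_proj_def
proof (intro conjI allI)
  show "selfadjoint Q"
    by (rule strong_limit_selfadjoint[OF F L]) (use ev in \<open>eventually_elim, simp add: orth_proj_sa\<close>)
  fix \<xi>
  have b: "\<forall>\<^sub>F i in F. norm (P i) \<le> 1" using ev by eventually_elim (rule norm_orth_proj)
  have "((\<lambda>i. P i \<xi>) \<longlongrightarrow> Q (Q \<xi>)) F"
  proof (rule Lim_transform_eventually)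
    show "((\<lambda>i. P i (P i \<xi>)) \<longlongrightarrow> Q (Q \<xi>)) F"
      by (rule tendsto_blinfun_apply_bounded[OF L b strong_limitD[OF L]])
    show "\<forall>\<^sub>F i in F. P i (P i \<xi>) = P i \<xi>" using ev by eventually_elim (rule orth_proj_idem)
  qed
  then show "Q (Q \<xi>) = Q \<xi>" using tendsto_unique[OF F strong_limitD[OF L]] by metis
qed

lemma strong_limit_proj_le_left:
  assumes F: "F \<noteq> bot" and L: "strong_limit P Q F" and ev: "\<forall>\<^sub>F i in F. proj_le (P i) R"
  shows "proj_le Q R"
  unfolding proj_le_def
proof
  fix \<xi>
  have "((\<lambda>i. P i \<xi>) \<longlongrightarrow> R (Q \<xi>)) F"
  proof (rule Lim_transform_eventually)
    show "((\<lambda>i. R (P i \<xi>)) \<longlongrightarrow> R (Q \<xi>)) F" by (intro blinfun.tendsto tendsto_const strong_limitD L)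
    show "\<forall>\<^sub>F i in F. R (P i \<xi>) = P i \<xi>" using ev by eventually_elim (simp add: proj_le_def)
  qed
  then show "R (Q \<xi>) = Q \<xi>" using tendsto_unique[OF F strong_limitD[OF L]] by metis
qed

lemma strong_limit_proj_le_right:
  assumes F: "F \<noteq> bot" and L: "strong_limit P Q F" and ev: "\<forall>\<^sub>F i in F. proj_le R (P i)"
  shows "proj_le R Q"
  unfolding proj_le_def
proof
  fix \<xi>
  have "((\<lambda>i. P i (R \<xi>)) \<longlongrightarrow> R \<xi>) F"
  proof (rule Lim_transform_eventually)
    show "((\<lambda>i. R \<xi>) \<longlongrightarrow> R \<xi>) F" by simp
    show "\<forall>\<^sub>F i in F. R \<xi> = P i (R \<xi>)" using ev by eventually_elim (simp add: proj_le_def)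
  qed
  then show "Q (R \<xi>) = R \<xi>" using tendsto_unique[OF F strong_limitD[OF L]] by metis
qed

section \<open>Monotone nets of projections\<close>

lemma net_filter_not_bot:
  assumes "directed_set I r"
  shows "net_filter I r \<noteq> bot"
proof -
  have "\<not> eventually (\<lambda>_. False) (net_filter I r)"
    unfolding eventually_net_filter[OF assms] using assms
    by (auto simp: directed_set_def reflp_on_def)
  then show ?thesis by (simp add: trivial_limit_def)
qed

lemma eventually_net_filterI:
  assumes "directed_set I r" "a \<in> I" "\<And>b. b \<in> I \<Longrightarrow> r a b \<Longrightarrow> P b"
  shows "eventually P (net_filter I r)"
  using assms by (auto simp: eventually_net_filter)

lemma eventually_net_in: "directed_set I r \<Longrightarrow> \<forall>\<^sub>F i in net_filter I r. i \<in> I"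
  by (metis directed_set_def ex_in_conv eventually_net_filterI)

lemma incseq_net_Cauchy:
  fixes a :: "'i \<Rightarrow> real"
  assumes I: "directed_set I r" and mono: "\<And>i j. i \<in> I \<Longrightarrow> j \<in> I \<Longrightarrow> r i j \<Longrightarrow> a i \<le> a j"
    and bdd: "\<And>i. i \<in> I \<Longrightarrow> a i \<le> C" and e: "0 < e"
  shows "\<exists>k\<in>I. \<forall>i\<in>I. r k i \<longrightarrow> \<bar>a i - a k\<bar> < e"
proof -
  have ne: "a ` I \<noteq> {}" and ba: "bdd_above (a ` I)"
    using I bdd by (auto simp: directed_set_def intro!: bdd_aboveI[of _ C])
  have "Sup (a ` I) - e < Sup (a ` I)" using e by simp
  then obtain k where k: "k \<in> I" "Sup (a ` I) - e < a k"
    using less_cSup_iff[OF ne ba] by auto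
  have "\<bar>a i - a k\<bar> < e" if "i \<in> I" "r k i" for i
    using mono[OF k(1) that] cSup_upper[OF imageI[OF that(1)] ba] k(2) by linarith
  then show ?thesis using k(1) by blast
qed

text \<open>
  For comparable projections, \<open>\<parallel>P \<xi> - Q \<xi>\<parallel>\<^sup>2\<close> is the difference of \<open>\<parallel>P \<xi>\<parallel>\<^sup>2\<close> and \<open>\<parallel>Q \<xi>\<parallel>\<^sup>2\<close>, and these
  numbers form a bounded monotone net.
\<close>

lemma orth_proj_net_converges:
  fixes P :: "'i \<Rightarrow> 'h::chilbert_space \<Rightarrow>\<^sub>L 'h"
  assumes I: "directed_set I r" and P: "\<And>i. i \<in> I \<Longrightarrow> orth_proj (P i)"
    and mono: "(\<forall>i\<in>I. \<forall>j\<in>I. r i j \<longrightarrow> proj_le (P i) (P j)) \<or> (\<forall>i\<in>I. \<forall>j\<in>I. r i j \<longrightarrow> proj_le (P j) (P i))"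
  obtains Q where "strong_limit P Q (net_filter I r)" "orth_proj Q"
proof -
  let ?F = "net_filter I r"
  have F: "?F \<noteq> bot" by (rule net_filter_not_bot[OF I])
  have ev: "\<forall>\<^sub>F i in ?F. orth_proj (P i)" using eventually_net_in[OF I] by eventually_elim (rule P)
  have b: "\<forall>\<^sub>F i in ?F. norm (P i) \<le> 1" using ev by eventually_elim (rule norm_orth_proj)
  have "\<exists>\<eta>. ((\<lambda>i. P i \<xi>) \<longlongrightarrow> \<eta>) ?F" for \<xi>
  proof -
    define a where "a i = (norm (P i \<xi>))\<^sup>2" for i
    have a_mono: "a i \<le> a j" if "i \<in> I" "j \<in> I" "proj_le (P i) (P j)" for i j
      using proj_le_iff_rinner[of "P i" "P j"] that by (simp add: a_def P rinner_orth_proj)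
    have a_bd: "a i \<le> (norm \<xi>)\<^sup>2" "- a i \<le> 0" if "i \<in> I" for i
      unfolding a_def by (intro power_mono norm_orth_proj_le P that) simp_all
    have a_Cauchy: "\<exists>k\<in>I. \<forall>i\<in>I. r k i \<longrightarrow> \<bar>a i - a k\<bar> < e" if "0 < e" for e
      using mono
    proof
      assume "\<forall>i\<in>I. \<forall>j\<in>I. r i j \<longrightarrow> proj_le (P i) (P j)"
      then show ?thesis by (intro incseq_net_Cauchy[OF I _ a_bd(1) that] a_mono) blast+
    next
      assume "\<forall>i\<in>I. \<forall>j\<in>I. r i j \<longrightarrow> proj_le (P j) (P i)"
      then have "\<exists>k\<in>I. \<forall>i\<in>I. r k i \<longrightarrow> \<bar>- a i - - a k\<bar> < e"
        by (intro incseq_net_Cauchy[OF I _ a_bd(2) that]) (auto intro!: a_mono)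
      then show ?thesis by (simp add: abs_minus_commute)
    qed
    have dist_sq: "(norm (P i \<xi> - P k \<xi>))\<^sup>2 = \<bar>a i - a k\<bar>" if "i \<in> I" "k \<in> I" "r k i" for i k
    proof -
      have "proj_le (P i) (P k) \<or> proj_le (P k) (P i)" using mono that by blast
      then show ?thesis
      proof
        assume "proj_le (P i) (P k)"
        with norm_proj_diff[of "P i" "P k" \<xi>] a_mono[of i k] that show ?thesis
          by (simp add: P a_def norm_minus_commute)
      next
        assume "proj_le (P k) (P i)"
        with norm_proj_diff[of "P k" "P i" \<xi>] a_mono[of k i] that show ?thesis
          by (simp add: P a_def)
      qed
    qed
    have C: "\<exists>p. eventually p ?F \<and> (\<forall>i j. p i \<and> p j \<longrightarrow> dist (P i \<xi>) (P j \<xi>) < e)" if e: "0 < e" for e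
    proof -
      obtain k where k: "k \<in> I" "\<And>i. i \<in> I \<Longrightarrow> r k i \<Longrightarrow> \<bar>a i - a k\<bar> < (e/2)\<^sup>2"
        using a_Cauchy[of "(e/2)\<^sup>2"] e by auto
      have near: "dist (P i \<xi>) (P k \<xi>) < e / 2" if "i \<in> I" "r k i" for i
      proof -
        have "(norm (P i \<xi> - P k \<xi>))\<^sup>2 < (e/2)\<^sup>2"
          using dist_sq[OF that(1) k(1) that(2)] k(2)[OF that] by simp
        then show ?thesis using e unfolding dist_norm by (intro power_less_imp_less_base[of "norm _" 2 "_ / _"]) simp_all
      qed
      show ?thesis
      proof (intro exI[of _ "\<lambda>i. i \<in> I \<and> r k i"] conjI allI impI)
        show "eventually (\<lambda>i. i \<in> I \<and> r k i) ?F" by (rule eventually_net_filterI[OF I k(1)]) simp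
        fix i j assume ij: "(i \<in> I \<and> r k i) \<and> (j \<in> I \<and> r k j)"
        show "dist (P i \<xi>) (P j \<xi>) < e"
          by (rule dist_triangle_half_l[of _ "P k \<xi>"]) (use near ij in blast)+
      qed
    qed
    obtain \<eta> where "((\<lambda>i. P i \<xi>) \<longlongrightarrow> \<eta>) ?F" by (rule convergentI_Cauchy_filter[OF F C])
    then show ?thesis by blast
  qed
  then obtain Q where Q: "strong_limit P Q ?F" by (rule strong_limit_exists[OF F b])
  show ?thesis by (rule that[OF Q strong_limit_orth_proj[OF F Q ev]])
qed

section \<open>The algebra, its projections and its unit\<close>

locale von_neumann =
  fixes M :: "('h::chilbert_space \<Rightarrow>\<^sub>L 'h) set"
  assumes vna: "von_neumann_algebra M"
begin

lemma M_bounded_ops: "T \<in> M \<Longrightarrow> T \<in> bounded_ops"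
  and M_zero: "0 \<in> M"
  and M_add: "S \<in> M \<Longrightarrow> T \<in> M \<Longrightarrow> S + T \<in> M"
  and M_scaleC: "T \<in> M \<Longrightarrow> op_scaleC c T \<in> M"
  and M_comp: "S \<in> M \<Longrightarrow> T \<in> M \<Longrightarrow> S o\<^sub>L T \<in> M"
  and M_adj: "T \<in> M \<Longrightarrow> adj T \<in> M"
  and M_closedin: "closedin sot M"
  using vna unfolding von_neumann_algebra_def cstar_subalgebra_def by blast+

lemma M_scaleR: "T \<in> M \<Longrightarrow> a *\<^sub>R T \<in> M"
proof -
  assume T: "T \<in> M"
  have "op_scaleC (complex_of_real a) T = a *\<^sub>R T"
    by (rule blinfun_eqI)
      (simp add: op_scaleC_def scaleR_eq_scaleC[symmetric] blinfun.scaleR_left bounded_linear_Blinfun_apply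
        bounded_linear_scaleR_const bounded_linear_const_scaleR blinfun.bounded_linear_right)
  then show ?thesis using M_scaleC[OF T, of "complex_of_real a"] by simp
qed

lemma M_diff: "S \<in> M \<Longrightarrow> T \<in> M \<Longrightarrow> S - T \<in> M"
  using M_add[of S "(-1) *\<^sub>R T"] M_scaleR[of T "-1"] by simp

lemma M_strong_limit:
  assumes "F \<noteq> bot" "\<forall>\<^sub>F i in F. T i \<in> M" "strong_limit T S F"
  shows "S \<in> M"
proof -
  have ev: "\<forall>\<^sub>F i in F. T i \<in> bounded_ops" using assms(2) by eventually_elim (rule M_bounded_ops)
  then have "limitin sot T S F"
    using strong_limit_bounded_ops[OF assms(1,3)] assms(3) by (simp add: limitin_sot)
  then show ?thesis using limitin_closedin[OF _ M_closedin assms(2,1)] by blast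
qed

lemma sa_part_iff: "x \<in> sa_part M \<longleftrightarrow> x \<in> M \<and> selfadjoint x"
  using adj_eq_self_iff M_bounded_ops by (auto simp: sa_part_def)

lemma projections_iff: "p \<in> projections M \<longleftrightarrow> p \<in> M \<and> orth_proj p"
proof -
  have "p o\<^sub>L p = p \<longleftrightarrow> (\<forall>\<xi>. p (p \<xi>) = p \<xi>)"
    by (metis blinfun_apply_blinfun_compose blinfun_eqI comp_apply)
  then show ?thesis using adj_eq_self_iff M_bounded_ops by (auto simp: projections_def orth_proj_def)
qed

lemma projectionsD: "p \<in> projections M \<Longrightarrow> p \<in> M" "p \<in> projections M \<Longrightarrow> orth_proj p"
  by (simp_all add: projections_iff)

text \<open>
  The quadratic form of a self-adjoint complex linear operator is real, so the real part decides
  positivity.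
\<close>

lemma op_le_iff_rinner:
  assumes "S \<in> M" "T \<in> M" "selfadjoint S" "selfadjoint T"
  shows "op_le S T \<longleftrightarrow> (\<forall>\<xi>. rinner (S \<xi>) \<xi> \<le> rinner (T \<xi>) \<xi>)"
proof -
  let ?D = "T - S"
  have D: "selfadjoint ?D" "?D \<in> bounded_ops"
    using assms M_bounded_ops[OF M_diff]
    by (auto simp: selfadjoint_def blinfun.diff_left rinner.diff_left rinner.diff_right)
  have "cinner (?D \<xi>) \<xi> \<in> \<real>\<^sub>\<ge>\<^sub>0 \<longleftrightarrow> 0 \<le> rinner (?D \<xi>) \<xi>" for \<xi>
  proof -
    have "rinner (\<i> *\<^sub>C ?D \<xi>) \<xi> = 0"
    proof -
      have "rinner (\<i> *\<^sub>C ?D \<xi>) \<xi> = rinner (\<i> *\<^sub>C \<xi>) (?D \<xi>)"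
        using D by (simp add: bounded_ops_def selfadjointD[OF D(1), symmetric])
      moreover have "rinner (\<i> *\<^sub>C \<xi>) (?D \<xi>) = - rinner \<xi> (\<i> *\<^sub>C ?D \<xi>)"
        unfolding rinner_def
        by (subst (2) cinner_commute) (simp add: cinner_scaleC_left, subst cinner_commute, simp)
      ultimately show ?thesis by (simp add: rinner_commute)
    qed
    then show ?thesis by (simp add: cinner_eq_rinner complex_nonneg_Reals_iff)
  qed
  then show ?thesis using D(2)
    by (simp add: op_le_def positive_op_def blinfun.diff_left rinner.diff_left)
qed

lemma op_le_iff: "p \<in> projections M \<Longrightarrow> q \<in> projections M \<Longrightarrow> op_le p q \<longleftrightarrow> proj_le p q"
  by (simp add: projections_iff op_le_iff_rinner proj_le_iff_rinner orth_proj_sa)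

text \<open>
  The induction runs over \<open>T q(T)\<close>, because a constant term would leave an algebra that does not
  contain the identity operator.
\<close>

lemma poly_op_in_M:
  assumes T: "T \<in> M" and p: "coeff p 0 = 0"
  shows "poly_op p T \<in> M"
proof -
  have "T o\<^sub>L poly_op q T \<in> M" for q
  proof (induction q)
    case 0
    have "T o\<^sub>L 0 = 0" by (rule blinfun_eqI) simp
    then show ?case by (simp add: M_zero)
  next
    case (pCons a q)
    have "T o\<^sub>L poly_op (pCons a q) T = a *\<^sub>R T + (T o\<^sub>L (T o\<^sub>L poly_op q T))"
      by (rule blinfun_eqI) (simp add: blinfun.bilinear_simps)
    then show ?case by (simp add: M_add M_scaleR M_comp T pCons.IH)
  qed
  moreover obtain q where "p = pCons 0 q" using p by (cases p) auto
  ultimately show ?thesis by simp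
qed

lemma sign_poly_in_M: "T \<in> M \<Longrightarrow> poly_op (sign_poly n) T \<in> M"
proof (rule poly_op_in_M)
  show "coeff (sign_poly n) 0 = 0"
    by (induction n) (simp_all add: sign_poly_0 sign_poly_Suc coeff_mult_0)
qed

lemma sign_operator_in_M: "T \<in> M \<Longrightarrow> strong_limit (\<lambda>n. poly_op (sign_poly n) T) S sequentially \<Longrightarrow> S \<in> M"
  by (rule M_strong_limit) (simp_all add: sign_poly_in_M)

text \<open>
  The square of the sign of \<open>T\<close> is a projection, and \<open>T\<close> vanishes on its complement.
\<close>

lemma exists_support_projection:
  assumes T: "T \<in> M" "selfadjoint T"
  obtains P where "P \<in> projections M" "\<And>\<xi>. T (P \<xi>) = T \<xi>"
proof -
  define c where "c = norm T + 1"
  define R where "R = (1/c) *\<^sub>R T"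
  have c: "c > 0" by (simp add: c_def add_nonneg_pos)
  have R: "R \<in> M" "selfadjoint R" "norm R \<le> 1"
    using T c by (simp_all add: R_def M_scaleR selfadjoint_def blinfun.scaleR_left
        rinner.scaleR_left rinner.scaleR_right) (simp add: c_def)
  obtain S where S: "strong_limit (\<lambda>n. poly_op (sign_poly n) R) S sequentially" "selfadjoint S"
    and SSS: "\<And>\<xi>. S (S (S \<xi>)) = S \<xi>"
    and RS: "\<And>\<xi>. (norm (R \<xi>))\<^sup>2 \<le> rinner (R (S \<xi>)) \<xi>"
    using sign_operator[OF R(2,3)] by metis
  let ?P = "S o\<^sub>L S"
  have "S \<in> M" by (rule sign_operator_in_M[OF R(1) S(1)])
  then have "?P \<in> projections M"
    using S(2) by (auto simp: projections_iff M_comp orth_proj_def selfadjoint_def SSS)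
  moreover have "T (?P \<xi>) = T \<xi>" for \<xi>
  proof -
    have "S (\<xi> - ?P \<xi>) = 0" by (simp add: blinfun.diff_right SSS)
    then have "(norm (R (\<xi> - ?P \<xi>)))\<^sup>2 \<le> 0" using RS[of "\<xi> - ?P \<xi>"] by (simp add: rinner.zero_left)
    then show ?thesis using c by (simp add: R_def blinfun.bilinear_simps)
  qed
  ultimately show ?thesis by (rule that)
qed

text \<open>
  A common upper bound of \<open>P\<close> and \<open>Q\<close> is a support of \<open>P + Q\<close>: the quadratic form of a sum of positive
  operators vanishes only where both forms do.
\<close>

lemma projections_directed: "directed_set (projections M) op_le"
  unfolding directed_set_def
proof (intro conjI ballI)
  show "projections M \<noteq> {}"
  proof -
    have "0 \<in> projections M" by (simp add: projections_iff M_zero orth_proj_def selfadjoint_def rinner.zero_left rinner.zero_right)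
    then show ?thesis by blast
  qed
  show "reflp_on (projections M) op_le"
    by (auto simp: reflp_on_def op_le_iff proj_le_refl projectionsD)
  show "transp_on (projections M) op_le"
    by (auto simp: transp_on_def op_le_iff intro: proj_le_trans)
  fix P Q assume PQ: "P \<in> projections M" "Q \<in> projections M"
  note op = projectionsD(2)[OF PQ(1)] projectionsD(2)[OF PQ(2)]
  have "P + Q \<in> M" "selfadjoint (P + Q)"
    using PQ by (auto simp: projections_iff M_add orth_proj_def selfadjoint_def blinfun.add_left
        rinner.add_left rinner.add_right)
  then obtain R where R: "R \<in> projections M" "\<And>\<xi>. (P + Q) (R \<xi>) = (P + Q) \<xi>"
    using exists_support_projection by metis
  have "P (R \<xi>) = P \<xi> \<and> Q (R \<xi>) = Q \<xi>" for \<xi>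
  proof -
    define \<eta> where "\<eta> = \<xi> - R \<xi>"
    have "(P + Q) \<eta> = 0" using R(2)[of \<xi>] by (simp add: \<eta>_def blinfun.diff_right)
    then have "rinner (P \<eta>) \<eta> + rinner (Q \<eta>) \<eta> = 0"
      by (metis blinfun.add_left rinner.add_left rinner.zero_left)
    then have "(norm (P \<eta>))\<^sup>2 + (norm (Q \<eta>))\<^sup>2 = 0" by (simp add: rinner_orth_proj op)
    then have "P \<eta> = 0" "Q \<eta> = 0" by (simp_all add: add_nonneg_eq_0_iff)
    then show ?thesis by (simp add: \<eta>_def blinfun.diff_right)
  qed
  then have "op_le P R" "op_le Q R"
    using PQ R(1) by (simp_all add: op_le_iff proj_leI projectionsD)
  then show "\<exists>R\<in>projections M. op_le P R \<and> op_le Q R" using R(1) by blast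
qed

text \<open>
  The unit is the supremum of all projections. It absorbs self-adjoint elements because it
  dominates their supports, and an arbitrary \<open>T\<close> because it absorbs \<open>T\<^sup>* T\<close>.
\<close>

lemma exists_unit: "\<exists>e\<in>projections M. \<forall>T\<in>M. e o\<^sub>L T = T \<and> T o\<^sub>L e = T"
proof -
  let ?F = "net_filter (projections M) op_le"
  obtain e where e: "strong_limit (\<lambda>p. p) e ?F" "orth_proj e"
    by (rule orth_proj_net_converges[OF projections_directed, of "\<lambda>p. p"])
      (auto simp: op_le_iff projectionsD)
  have eM: "e \<in> M"
    by (rule M_strong_limit[OF net_filter_not_bot[OF projections_directed] _ e(1)])
      (use eventually_net_in[OF projections_directed] in \<open>eventually_elim, simp add: projectionsD\<close>)
  have le: "proj_le p e" if "p \<in> projections M" for p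
    by (rule strong_limit_proj_le_right[OF net_filter_not_bot[OF projections_directed] e(1)],
        rule eventually_net_filterI[OF projections_directed that])
      (simp add: op_le_iff that)
  have sa: "T (e \<xi>) = T \<xi>" if T: "T \<in> M" "selfadjoint T" for T \<xi>
  proof -
    obtain P where P: "P \<in> projections M" "\<And>\<xi>. T (P \<xi>) = T \<xi>"
      using exists_support_projection[OF T] by metis
    have "T (e \<xi>) = T (P (e \<xi>))" by (simp add: P(2))
    also have "\<dots> = T (P \<xi>)" by (simp add: proj_leD[OF projectionsD(2)[OF P(1)] e(2) le[OF P(1)]])
    finally show ?thesis by (simp add: P(2))
  qed
  have right: "T (e \<xi>) = T \<xi>" if T: "T \<in> M" for T \<xi>
  proof -
    let ?A = "adj T o\<^sub>L T" and ?\<eta> = "\<xi> - e \<xi>"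
    have "selfadjoint ?A"
      unfolding selfadjoint_def
      by (simp add: rinner_adj[OF M_bounded_ops[OF T], symmetric] rinner_commute[of "adj T _"])
        (simp add: rinner_commute rinner_adj[OF M_bounded_ops[OF T]])
    then have "?A ?\<eta> = 0"
      using sa[of ?A \<xi>] T by (simp add: M_comp M_adj blinfun.diff_right)
    then have "rinner (T ?\<eta>) (T ?\<eta>) = 0"
      by (simp add: rinner_adj[OF M_bounded_ops[OF T]] rinner.zero_right)
    then show ?thesis by (simp add: rinner_self blinfun.diff_right)
  qed
  have left: "e (T \<xi>) = T \<xi>" if T: "T \<in> M" for T \<xi>
  proof (rule rinner_eqI)
    fix \<zeta>
    have a: "rinner \<eta> (T \<xi>) = rinner (adj T \<eta>) \<xi>" for \<eta>
      by (metis rinner_commute rinner_adj[OF M_bounded_ops[OF T]])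
    have "rinner \<zeta> (e (T \<xi>)) = rinner (adj T (e \<zeta>)) \<xi>"
      by (simp add: selfadjointD[OF orth_proj_sa[OF e(2)], symmetric] a)
    then show "rinner \<zeta> (e (T \<xi>)) = rinner \<zeta> (T \<xi>)" by (simp add: right M_adj T a)
  qed
  show ?thesis
    by (intro bexI[of _ e] ballI conjI blinfun_eqI) (simp_all add: left right projections_iff eM e(2))
qed

abbreviation "unit_op \<equiv> alg_unit M"

lemma alg_unit_properties: "unit_op \<in> projections M \<and> (\<forall>T\<in>M. unit_op o\<^sub>L T = T \<and> T o\<^sub>L unit_op = T)"
proof -
  obtain u where u: "u \<in> projections M" "\<forall>T\<in>M. u o\<^sub>L T = T \<and> T o\<^sub>L u = T"
    using exists_unit by blast
  have "alg_unit M = u"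
    unfolding alg_unit_def
  proof (rule the_equality)
    show "u \<in> M \<and> (\<forall>T\<in>M. u o\<^sub>L T = T \<and> T o\<^sub>L u = T)" using u by (simp add: projectionsD)
    show "v = u" if "v \<in> M \<and> (\<forall>T\<in>M. v o\<^sub>L T = T \<and> T o\<^sub>L v = T)" for v
      using that u projectionsD(1)[OF u(1)] by metis
  qed
  then show ?thesis using u by simp
qed

lemma unit_proj: "unit_op \<in> projections M"
  using alg_unit_properties by blast

lemma unit_left: "T \<in> M \<Longrightarrow> unit_op (T \<xi>) = T \<xi>"
  and unit_right: "T \<in> M \<Longrightarrow> T (unit_op \<xi>) = T \<xi>"
  by (metis alg_unit_properties blinfun_apply_blinfun_compose comp_apply)+

lemma proj_le_unit: "p \<in> projections M \<Longrightarrow> proj_le p unit_op"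
  by (simp add: proj_le_def unit_left projectionsD)

lemma projection_net_limit:
  assumes I: "directed_set I r" and P: "\<And>i. i \<in> I \<Longrightarrow> P i \<in> projections M"
    and mono: "(\<forall>i\<in>I. \<forall>j\<in>I. r i j \<longrightarrow> proj_le (P i) (P j)) \<or> (\<forall>i\<in>I. \<forall>j\<in>I. r i j \<longrightarrow> proj_le (P j) (P i))"
  obtains Q where "strong_limit P Q (net_filter I r)" "Q \<in> projections M"
proof -
  obtain Q where Q: "strong_limit P Q (net_filter I r)" "orth_proj Q"
    using orth_proj_net_converges[OF I _ mono] P projectionsD(2) by blast
  have "Q \<in> M"
    by (rule M_strong_limit[OF net_filter_not_bot[OF I] _ Q(1)])
      (use eventually_net_in[OF I] in \<open>eventually_elim, simp add: P projectionsD\<close>)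
  then show ?thesis using Q that by (simp add: projections_iff)
qed

section \<open>Spectral cuts\<close>

text \<open>
  The algebra need not contain the identity operator, so the complement of \<open>P\<close> is taken below
  the unit of the algebra. On the eigenspace of \<open>x\<close> for \<open>l\<close> both inequalities hold, which leaves
  the choice of \<open>P\<close> open there and makes the notion stable under strong limits.
\<close>

definition spectral_cut :: "('h \<Rightarrow>\<^sub>L 'h) \<Rightarrow> real \<Rightarrow> ('h \<Rightarrow>\<^sub>L 'h) \<Rightarrow> bool"
  where "spectral_cut x l P \<longleftrightarrow> P \<in> projections M \<and> (\<forall>\<xi>. P (x \<xi>) = x (P \<xi>)) \<and>
    (\<forall>\<xi>. rinner (x (P \<xi>)) (P \<xi>) \<le> l * (norm (P \<xi>))\<^sup>2) \<and>
    (\<forall>\<xi>. l * (norm (unit_op \<xi> - P \<xi>))\<^sup>2 \<le> rinner (x (unit_op \<xi> - P \<xi>)) (unit_op \<xi> - P \<xi>))"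

lemma spectral_cutD:
  assumes "spectral_cut x l P"
  shows "P \<in> projections M" "P (x \<xi>) = x (P \<xi>)"
    "rinner (x (P \<xi>)) (P \<xi>) \<le> l * (norm (P \<xi>))\<^sup>2"
    "l * (norm (unit_op \<xi> - P \<xi>))\<^sup>2 \<le> rinner (x (unit_op \<xi> - P \<xi>)) (unit_op \<xi> - P \<xi>)"
  using assms by (auto simp: spectral_cut_def)

text \<open>
  Let \<open>S\<close> be the sign of the rescaled \<open>x - l\<close>. Then \<open>K = (S\<^sup>2 + S) / 2\<close> is the projection onto the
  part where \<open>x > l\<close>, and the cut is its complement. As a limit of polynomials in \<open>x\<close> and the unit it
  commutes with all elements of the algebra that commute with \<open>x\<close>; arbitrary cuts are compared
  with the help of this one.
\<close>

lemma exists_spectral_cut: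
  assumes x: "x \<in> M" "selfadjoint x"
  obtains P where "spectral_cut x l P"
    and "\<And>Y \<xi>. Y \<in> M \<Longrightarrow> (\<And>\<xi>. Y (x \<xi>) = x (Y \<xi>)) \<Longrightarrow> P (Y \<xi>) = Y (P \<xi>)"
proof -
  define c where "c = norm (x - l *\<^sub>R unit_op) + 1"
  define T where "T = (1/c) *\<^sub>R (x - l *\<^sub>R unit_op)"
  have u: "unit_op \<in> M" "orth_proj unit_op" using unit_proj by (simp_all add: projectionsD)
  have c: "c > 0" by (simp add: c_def add_nonneg_pos)
  have TM: "T \<in> M" unfolding T_def by (intro M_scaleR M_diff x u)
  have Tsa: "selfadjoint T"
    using x(2) orth_proj_sa[OF u(2)] unfolding T_def selfadjoint_def
    by (simp add: blinfun.bilinear_simps rinner.diff_left rinner.diff_right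
        rinner.scaleR_left rinner.scaleR_right)
  have T1: "norm T \<le> 1" using c by (simp add: T_def c_def)
  have x_eq: "x \<xi> = c *\<^sub>R T \<xi> + l *\<^sub>R unit_op \<xi>" for \<xi>
    using c by (simp add: T_def blinfun.bilinear_simps)
  obtain S where S: "strong_limit (\<lambda>n. poly_op (sign_poly n) T) S sequentially" "selfadjoint S"
    and SSS: "\<And>\<xi>. S (S (S \<xi>)) = S \<xi>"
    and TS: "\<And>\<xi>. (norm (T \<xi>))\<^sup>2 \<le> rinner (T (S \<xi>)) \<xi>"
    using sign_operator[OF Tsa T1] by metis
  have SM: "S \<in> M" by (rule sign_operator_in_M[OF TM S(1)])
  define K where "K = (1/2) *\<^sub>R ((S o\<^sub>L S) + S)"
  have K_app: "K \<xi> = (1/2) *\<^sub>R (S (S \<xi>) + S \<xi>)" for \<xi> by (simp add: K_def blinfun.bilinear_simps)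
  have SK: "S (K \<xi>) = K \<xi>" for \<xi> by (simp add: K_app blinfun.bilinear_simps SSS add.commute)
  have KM: "K \<in> M" unfolding K_def by (intro M_scaleR M_add M_comp SM)
  have "orth_proj K"
    unfolding orth_proj_def
  proof (intro conjI allI)
    show "selfadjoint K"
      using S(2) unfolding selfadjoint_def K_app
      by (simp add: rinner.add_left rinner.add_right rinner.scaleR_left rinner.scaleR_right)
    show "K (K \<xi>) = K \<xi>" for \<xi>
      by (subst K_app) (simp add: SK scaleR_2[symmetric])
  qed
  then have K: "K \<in> projections M" using KM by (simp add: projections_iff)
  define P where "P = unit_op - K"
  have P: "P \<in> projections M"
    using orth_proj_diff[OF projectionsD(2)[OF K] u(2) proj_le_unit[OF K]] M_diff[OF u(1) KM]
    by (simp add: P_def projections_iff)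
  have comm: "P (Y \<xi>) = Y (P \<xi>)" if Y: "Y \<in> M" "\<And>\<xi>. Y (x \<xi>) = x (Y \<xi>)" for Y \<xi>
  proof -
    have "T (Y \<xi>) = Y (T \<xi>)" for \<xi>
      by (simp add: T_def blinfun.bilinear_simps Y unit_left unit_right)
    then have "poly_op p T (Y \<xi>) = Y (poly_op p T \<xi>)" for p \<xi> by (rule poly_op_commute)
    then have "S (Y \<xi>) = Y (S \<xi>)" for \<xi> by (intro strong_limit_commute[OF _ S(1)]) simp_all
    then show ?thesis by (simp add: P_def K_app blinfun.bilinear_simps unit_left unit_right Y(1))
  qed
  have "spectral_cut x l P"
    unfolding spectral_cut_def
  proof (intro conjI allI)
    show "P \<in> projections M" by (rule P)
    show "P (x \<xi>) = x (P \<xi>)" for \<xi> by (rule comm[OF x(1)]) simp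
    fix \<xi>
    have x_form: "rinner (x \<eta>) \<eta> = c * rinner (T \<eta>) \<eta> + l * (norm \<eta>)\<^sup>2" if "unit_op \<eta> = \<eta>" for \<eta>
      by (simp add: x_eq that rinner.add_left rinner.scaleR_left rinner_self)
    show "rinner (x (P \<xi>)) (P \<xi>) \<le> l * (norm (P \<xi>))\<^sup>2"
    proof -
      \<comment> \<open>the parts of \<open>P \<xi>\<close> on which the sign is zero and minus one\<close>
      define z where "z = unit_op \<xi> - S (S \<xi>)"
      define m where "m = (1/2) *\<^sub>R (S (S \<xi>) - S \<xi>)"
      have "m + ((1/2) *\<^sub>R S (S \<xi>) + (1/2) *\<^sub>R S \<xi>) = (1/2) *\<^sub>R S (S \<xi>) + (1/2) *\<^sub>R S (S \<xi>)"
        by (simp add: m_def algebra_simps)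
      also have "\<dots> = S (S \<xi>)" by (simp add: scaleR_add_left[symmetric])
      finally have P_eq: "P \<xi> = z + m"
        by (simp add: P_def K_app z_def blinfun.bilinear_simps algebra_simps)
      have "S z = 0" by (simp add: z_def blinfun.bilinear_simps SSS unit_right SM)
      then have Tz: "T z = 0" using TS[of z] by (simp add: rinner.zero_left)
      have Sm: "S m = - m" by (simp add: m_def blinfun.bilinear_simps SSS algebra_simps)
      have "rinner (T (P \<xi>)) (P \<xi>) = rinner (P \<xi>) (T m)"
        by (simp add: P_eq blinfun.add_right Tz rinner_commute)
      also have "\<dots> = rinner m (T m)"
        by (simp add: selfadjointD[OF Tsa, symmetric] P_eq blinfun.add_right Tz)
      also have "\<dots> = - rinner (T (S m)) m"
        by (simp add: Sm blinfun.minus_right rinner.minus_left rinner.minus_right rinner_commute)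
      also have "\<dots> \<le> 0" using TS[of m] by (smt (verit) zero_le_power2)
      finally have "rinner (T (P \<xi>)) (P \<xi>) \<le> 0" .
      moreover have "unit_op (P \<xi>) = P \<xi>" by (simp add: unit_left projectionsD P)
      ultimately show ?thesis using c by (simp add: x_form mult_le_0_iff)
    qed
    show "l * (norm (unit_op \<xi> - P \<xi>))\<^sup>2 \<le> rinner (x (unit_op \<xi> - P \<xi>)) (unit_op \<xi> - P \<xi>)"
    proof -
      have "0 \<le> rinner (T (K \<xi>)) (K \<xi>)"
        using order_trans[OF zero_le_power2 TS[of "K \<xi>"]] by (simp add: SK)
      moreover have "unit_op (K \<xi>) = K \<xi>" by (simp add: unit_left KM)
      moreover have "unit_op \<xi> - P \<xi> = K \<xi>" by (simp add: P_def blinfun.diff_left)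
      ultimately show ?thesis using c by (simp add: x_form)
    qed
  qed
  then show ?thesis using that comm by blast
qed

text \<open>
  On a unit vector in the ranges of \<open>P\<close> and of the complement of \<open>Q\<close> the form of \<open>x\<close> would be at most
  \<open>l\<close> and at least \<open>m\<close>.
\<close>

lemma spectral_cut_le_commuting:
  assumes P: "spectral_cut x l P" and Q: "spectral_cut x m Q" and "l < m"
    and comm: "\<And>\<xi>. P (Q \<xi>) = Q (P \<xi>)"
  shows "proj_le P Q"
  unfolding proj_le_def
proof
  fix \<xi>
  have PM: "P \<in> M" "orth_proj P" using spectral_cutD(1)[OF P] by (simp_all add: projectionsD)
  define \<eta> where "\<eta> = unit_op (P \<xi>) - Q (P \<xi>)"
  have \<eta>: "\<eta> = P \<xi> - Q (P \<xi>)" by (simp add: \<eta>_def unit_left PM)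
  have "P \<eta> = \<eta>" by (simp add: \<eta> blinfun.diff_right comm orth_proj_idem PM)
  then have "m * (norm \<eta>)\<^sup>2 \<le> l * (norm \<eta>)\<^sup>2"
    using spectral_cutD(3)[OF P, of \<eta>] spectral_cutD(4)[OF Q, of "P \<xi>", folded \<eta>_def] by simp
  then have "(norm \<eta>)\<^sup>2 \<le> 0" using \<open>l < m\<close> by (metis mult_le_cancel_right not_le)
  then show "Q (P \<xi>) = P \<xi>" by (simp add: \<eta>)
qed

text \<open>
  The two cuts are not known to commute with each other, but both commute with the special cut at
  the midpoint, which therefore lies between them.
\<close>

lemma spectral_cut_mono:
  assumes x: "x \<in> sa_part M" and P: "spectral_cut x l P" and Q: "spectral_cut x m Q" and "l < m"
  shows "proj_le P Q"
proof -
  obtain R where R: "spectral_cut x ((l + m) / 2) R"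
    and comm: "\<And>Y \<xi>. Y \<in> M \<Longrightarrow> (\<And>\<xi>. Y (x \<xi>) = x (Y \<xi>)) \<Longrightarrow> R (Y \<xi>) = Y (R \<xi>)"
    using exists_spectral_cut[of x "(l + m) / 2"] x by (auto simp: sa_part_iff)
  have "R (P \<xi>) = P (R \<xi>)" "R (Q \<xi>) = Q (R \<xi>)" for \<xi>
    using P Q by (auto intro!: comm dest: spectral_cutD projectionsD)
  then have "proj_le P R" "proj_le R Q"
    using \<open>l < m\<close> by (auto intro!: spectral_cut_le_commuting[OF P R] spectral_cut_le_commuting[OF R Q])
  then show ?thesis by (rule proj_le_trans)
qed

lemma spectral_cut_limit:
  assumes F: "F \<noteq> bot" and cut: "\<forall>\<^sub>F i in F. spectral_cut (x i) (l i) (P i)"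
    and bd: "\<forall>\<^sub>F i in F. norm (x i) \<le> C"
    and x: "strong_limit x X F" and P: "strong_limit P Q F" and l: "(l \<longlongrightarrow> L) F"
  shows "spectral_cut X L Q"
proof -
  have op: "\<forall>\<^sub>F i in F. orth_proj (P i)"
    using cut by eventually_elim (simp add: spectral_cutD(1) projectionsD)
  then have P1: "\<forall>\<^sub>F i in F. norm (P i) \<le> 1" by eventually_elim (rule norm_orth_proj)
  have PM: "\<forall>\<^sub>F i in F. P i \<in> M" using cut by eventually_elim (simp add: spectral_cutD(1) projectionsD)
  note xv = tendsto_blinfun_apply_bounded[OF x bd]
  note Px = tendsto_blinfun_apply_bounded[OF P P1 strong_limitD[OF x]]
  have d: "((\<lambda>i. unit_op \<xi> - P i \<xi>) \<longlongrightarrow> unit_op \<xi> - Q \<xi>) F" for \<xi>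
    by (intro tendsto_intros strong_limitD[OF P])
  show ?thesis
    unfolding spectral_cut_def
  proof (intro conjI allI)
    show "Q \<in> projections M"
      unfolding projections_iff by (intro conjI M_strong_limit[OF F PM P] strong_limit_orth_proj[OF F P op])
    fix \<xi>
    have "((\<lambda>i. P i (x i \<xi>)) \<longlongrightarrow> X (Q \<xi>)) F"
    proof (rule Lim_transform_eventually)
      show "((\<lambda>i. x i (P i \<xi>)) \<longlongrightarrow> X (Q \<xi>)) F" by (rule xv[OF strong_limitD[OF P]])
      show "\<forall>\<^sub>F i in F. x i (P i \<xi>) = P i (x i \<xi>)"
        using cut by eventually_elim (metis spectral_cutD(2))
    qed
    then show "Q (X \<xi>) = X (Q \<xi>)" using tendsto_unique[OF F Px] by blast
    show "rinner (X (Q \<xi>)) (Q \<xi>) \<le> L * (norm (Q \<xi>))\<^sup>2"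
    proof (rule tendsto_le[OF F])
      show "((\<lambda>i. l i * (norm (P i \<xi>))\<^sup>2) \<longlongrightarrow> L * (norm (Q \<xi>))\<^sup>2) F"
        by (intro tendsto_intros l strong_limitD[OF P])
      show "((\<lambda>i. rinner (x i (P i \<xi>)) (P i \<xi>)) \<longlongrightarrow> rinner (X (Q \<xi>)) (Q \<xi>)) F"
        by (intro rinner.tendsto xv strong_limitD[OF P])
      show "\<forall>\<^sub>F i in F. rinner (x i (P i \<xi>)) (P i \<xi>) \<le> l i * (norm (P i \<xi>))\<^sup>2"
        using cut by eventually_elim (rule spectral_cutD(3))
    qed
    show "L * (norm (unit_op \<xi> - Q \<xi>))\<^sup>2 \<le> rinner (X (unit_op \<xi> - Q \<xi>)) (unit_op \<xi> - Q \<xi>)"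
    proof (rule tendsto_le[OF F])
      show "((\<lambda>i. l i * (norm (unit_op \<xi> - P i \<xi>))\<^sup>2) \<longlongrightarrow> L * (norm (unit_op \<xi> - Q \<xi>))\<^sup>2) F"
        by (intro tendsto_mult l tendsto_power tendsto_norm d)
      show "((\<lambda>i. rinner (x i (unit_op \<xi> - P i \<xi>)) (unit_op \<xi> - P i \<xi>)) \<longlongrightarrow>
          rinner (X (unit_op \<xi> - Q \<xi>)) (unit_op \<xi> - Q \<xi>)) F"
        by (intro rinner.tendsto xv d)
      show "\<forall>\<^sub>F i in F. l i * (norm (unit_op \<xi> - P i \<xi>))\<^sup>2
          \<le> rinner (x i (unit_op \<xi> - P i \<xi>)) (unit_op \<xi> - P i \<xi>)"
        using cut by eventually_elim (rule spectral_cutD(4))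
    qed
  qed
qed

lemma abs_rinner_blinfun_le: "\<bar>rinner (x \<xi>) \<xi>\<bar> \<le> norm x * (norm \<xi>)\<^sup>2" for x :: "'h \<Rightarrow>\<^sub>L 'h"
proof -
  have "norm (x \<xi>) * norm \<xi> \<le> norm x * norm \<xi> * norm \<xi>" by (intro mult_right_mono norm_blinfun) simp
  then show ?thesis using abs_rinner_le[of "x \<xi>" \<xi>] by (simp add: power2_eq_square mult.assoc)
qed

lemma spectral_cut_below:
  assumes P: "spectral_cut x l P" and l: "l < - norm x"
  shows "P = 0"
proof (rule blinfun_eqI)
  fix \<xi>
  have "- norm x * (norm (P \<xi>))\<^sup>2 \<le> l * (norm (P \<xi>))\<^sup>2"
    using abs_rinner_blinfun_le[of x "P \<xi>"] spectral_cutD(3)[OF P, of \<xi>] by simp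
  then have "(norm (P \<xi>))\<^sup>2 \<le> 0" using l by (metis mult_le_cancel_right not_le)
  then show "P \<xi> = blinfun_apply 0 \<xi>" by simp
qed

lemma spectral_cut_above:
  assumes P: "spectral_cut x l P" and l: "norm x < l"
  shows "P = unit_op"
proof (rule blinfun_eqI)
  fix \<xi>
  let ?\<eta> = "unit_op \<xi> - P \<xi>"
  have "l * (norm ?\<eta>)\<^sup>2 \<le> norm x * (norm ?\<eta>)\<^sup>2"
    using abs_rinner_blinfun_le[of x ?\<eta>] spectral_cutD(4)[OF P, of \<xi>] by simp
  then have "(norm ?\<eta>)\<^sup>2 \<le> 0" using l by (metis mult_le_cancel_right not_le)
  then show "P \<xi> = unit_op \<xi>" by simp
qed

text \<open>
  The two trivial cuts say that the form of \<open>x\<close> lies between \<open>- A\<close> and \<open>A\<close>.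
\<close>

lemma norm_le_of_spectral_cuts:
  assumes x: "x \<in> sa_part M" and A: "0 \<le> A"
    and lo: "spectral_cut x (- A) 0" and hi: "spectral_cut x A unit_op"
  shows "norm x \<le> A"
proof (rule selfadjoint_norm_bound[OF _ A])
  show "selfadjoint x" using x by (simp add: sa_part_iff)
  fix \<xi>
  have xM: "x \<in> M" using x by (simp add: sa_part_iff)
  have "rinner (x \<xi>) \<xi> = rinner (unit_op (x \<xi>)) \<xi>" by (simp add: unit_left xM)
  also have "\<dots> = rinner (x (unit_op \<xi>)) (unit_op \<xi>)"
    by (simp add: selfadjointD[OF orth_proj_sa[OF projectionsD(2)[OF unit_proj]]] unit_right xM)
  finally have eq: "rinner (x \<xi>) \<xi> = rinner (x (unit_op \<xi>)) (unit_op \<xi>)" .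
  have "\<bar>rinner (x \<xi>) \<xi>\<bar> \<le> A * (norm (unit_op \<xi>))\<^sup>2"
    using spectral_cutD(3)[OF hi, of \<xi>] spectral_cutD(4)[OF lo, of \<xi>] by (simp add: eq)
  also have "\<dots> \<le> A * (norm \<xi>)\<^sup>2"
    by (intro mult_left_mono power_mono norm_orth_proj_le projectionsD(2) unit_proj A) simp
  finally show "\<bar>rinner (x \<xi>) \<xi>\<bar> \<le> A * (norm \<xi>)\<^sup>2" .
qed

section \<open>Riemann sums of projection-valued functions\<close>

definition riemann_sum :: "(real \<Rightarrow> 'h \<Rightarrow>\<^sub>L 'h) \<Rightarrow> (real \<times> real set) set \<Rightarrow> 'h \<Rightarrow>\<^sub>L 'h"
  where "riemann_sum E p = (\<Sum>(t, K)\<in>p. t *\<^sub>R (E (Sup K) - E (Inf K)))"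

lemma tagged_division_intervalE:
  fixes a b :: real
  assumes "p tagged_division_of {a..b}" "(t, K) \<in> p"
  obtains c d where "K = {c..d}" "a \<le> c" "c \<le> t" "t \<le> d" "d \<le> b" "Inf K = c" "Sup K = d"
proof -
  have t: "t \<in> K" "K \<subseteq> {a..b}" using assms tagged_division_ofD(2,3) by blast+
  obtain c d where K: "K = {c..d}"
    using tagged_division_ofD(4)[OF assms] by (auto simp: cbox_interval)
  have "c \<le> t" "t \<le> d" using t(1) by (auto simp: K)
  moreover from this have "a \<le> c" "d \<le> b" using t(2) by (auto simp: K)
  ultimately show ?thesis using that K by auto
qed

text \<open>
  The increments of a monotone projection-valued function are projections, and they sum to the unit.
  So the form of a Riemann sum is a sum of its tags with nonnegative weights of known total.
\<close>

lemma riemann_sum_form: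
  assumes p: "p tagged_division_of {a..b}" "a \<le> b" and E0: "E a = 0" and E1: "E b = unit_op"
    and E: "\<And>l. orth_proj (E l)" and mono: "monotone (\<le>) proj_le E"
  shows "rinner (riemann_sum E p \<xi>) \<xi> = (\<Sum>(t, K)\<in>p. t * (norm (E (Sup K) \<xi> - E (Inf K) \<xi>))\<^sup>2)"
    and "(\<Sum>(t, K)\<in>p. (norm (E (Sup K) \<xi> - E (Inf K) \<xi>))\<^sup>2) = (norm (unit_op \<xi>))\<^sup>2"
    and "\<And>\<eta>. (\<Sum>(t, K)\<in>p. E (Sup K) \<eta> - E (Inf K) \<eta>) = unit_op \<eta>"
proof -
  have D: "orth_proj (E (Sup K) - E (Inf K))" if tK: "(t, K) \<in> p" for t K
    by (rule tagged_division_intervalE[OF p(1) tK]) (simp add: orth_proj_diff E monotoneD[OF mono])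
  have form: "rinner (E (Sup K) \<xi> - E (Inf K) \<xi>) \<xi> = (norm (E (Sup K) \<xi> - E (Inf K) \<xi>))\<^sup>2"
    if "(t, K) \<in> p" for t K
    using rinner_orth_proj[OF D[OF that], of \<xi>] by (simp add: blinfun.diff_left)
  show "rinner (riemann_sum E p \<xi>) \<xi> = (\<Sum>(t, K)\<in>p. t * (norm (E (Sup K) \<xi> - E (Inf K) \<xi>))\<^sup>2)"
    unfolding riemann_sum_def blinfun.sum_left rinner.sum_left
    by (rule sum.cong) (auto simp: blinfun.scaleR_left blinfun.diff_left rinner.scaleR_left form)
  show sums: "(\<Sum>(t, K)\<in>p. E (Sup K) \<eta> - E (Inf K) \<eta>) = unit_op \<eta>" for \<eta>
    using additive_tagged_division_1[OF p(2,1), of "\<lambda>l. E l \<eta>"] by (simp add: E0 E1)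
  have "(\<Sum>(t, K)\<in>p. (norm (E (Sup K) \<xi> - E (Inf K) \<xi>))\<^sup>2)
      = (\<Sum>(t, K)\<in>p. rinner (E (Sup K) \<xi> - E (Inf K) \<xi>) \<xi>)"
    by (rule sum.cong) (auto simp: form)
  also have "\<dots> = rinner (\<Sum>(t, K)\<in>p. E (Sup K) \<xi> - E (Inf K) \<xi>) \<xi>"
    unfolding rinner.sum_left by (rule sum.cong) auto
  also have "\<dots> = (norm (unit_op \<xi>))\<^sup>2"
    by (simp add: sums rinner_orth_proj projectionsD(2) unit_proj)
  finally show "(\<Sum>(t, K)\<in>p. (norm (E (Sup K) \<xi> - E (Inf K) \<xi>))\<^sup>2) = (norm (unit_op \<xi>))\<^sup>2" .
qed

lemma riemann_sum_selfadjoint: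
  assumes "\<And>l. selfadjoint (E l)"
  shows "selfadjoint (riemann_sum E p)"
  unfolding selfadjoint_def riemann_sum_def blinfun.sum_left rinner.sum_left rinner.sum_right
  by (intro allI sum.cong)
    (auto simp: blinfun.scaleR_left blinfun.diff_left rinner.scaleR_left rinner.scaleR_right
      rinner.diff_left rinner.diff_right selfadjointD[OF assms])

text \<open>
  Since \<open>x\<close> commutes with the increments, its form is the sum of its forms on their ranges. On the
  range of \<open>E s - E r\<close> it lies between \<open>r\<close> and \<open>s\<close>, hence within \<open>\<delta>\<close> of the tag.
\<close>

lemma riemann_sum_error:
  assumes x: "x \<in> sa_part M" and cut: "\<And>l. spectral_cut x l (E l)"
    and p: "p tagged_division_of {a..b}" "a \<le> b" and E0: "E a = 0" and E1: "E b = unit_op"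
    and \<delta>: "0 < \<delta>" and fine: "(\<lambda>t. ball t \<delta>) fine p"
  shows "norm (riemann_sum E p - x) \<le> \<delta>"
proof (rule selfadjoint_norm_bound)
  have E: "orth_proj (E l)" "E l \<in> M" for l using spectral_cutD(1)[OF cut] by (simp_all add: projectionsD)
  have mono: "monotone (\<le>) proj_le E"
    unfolding monotone_def using spectral_cut_mono[OF x cut cut] proj_le_refl[OF E(1)]
    by (metis order_le_less)
  have xsa: "selfadjoint x" "x \<in> M" using x by (simp_all add: sa_part_iff)
  show "selfadjoint (riemann_sum E p - x)"
    using riemann_sum_selfadjoint[of E p] E(1) xsa(1) unfolding selfadjoint_def orth_proj_def
    by (simp add: blinfun.diff_left rinner.diff_left rinner.diff_right)
  show "0 \<le> \<delta>" using \<delta> by simp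
  fix \<xi>
  define D where "D K = E (Sup K) - E (Inf K)" for K :: "real set"
  define d where "d K = E (Sup K) \<xi> - E (Inf K) \<xi>" for K :: "real set"
  have d_D: "d K = D K \<xi>" for K by (simp add: d_def D_def blinfun.diff_left)
  have term_bd: "\<bar>t * (norm (d K))\<^sup>2 - rinner (x (d K)) (d K)\<bar> \<le> \<delta> * (norm (d K))\<^sup>2"
    and term_eq: "rinner (D K (x \<xi>)) \<xi> = rinner (x (d K)) (d K)" if tK: "(t, K) \<in> p" for t K
  proof -
    obtain r s where K: "K = {r..s}" "a \<le> r" "r \<le> t" "t \<le> s" "s \<le> b" "Inf K = r" "Sup K = s"
      using tagged_division_intervalE[OF p(1) tK] by metis
    have "K \<subseteq> ball t \<delta>" using fine tK by (auto simp: fine_def)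
    moreover have "r \<in> K" "s \<in> K" using K(1,3,4) by simp_all
    ultimately have "r \<in> ball t \<delta>" "s \<in> ball t \<delta>" by blast+
    then have rs: "t - r < \<delta>" "s - t < \<delta>" by (auto simp: dist_real_def)
    have rs_le: "proj_le (E r) (E s)" using K by (intro monotoneD[OF mono]) simp
    note rs_eq = proj_leD[OF E(1) E(1) rs_le]
    have "orth_proj (D K)" by (simp add: D_def K(6,7) orth_proj_diff E rs_le)
    have "E s (d K) = d K" "E r (d K) = 0"
      by (simp_all add: d_def K(6,7) blinfun.diff_right rs_eq orth_proj_idem E)
    then have "r * (norm (d K))\<^sup>2 \<le> rinner (x (d K)) (d K)" "rinner (x (d K)) (d K) \<le> s * (norm (d K))\<^sup>2"
      using spectral_cutD(4)[OF cut, of r "d K"] spectral_cutD(3)[OF cut, of s "d K"]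
      by (simp_all add: d_def K(6,7) blinfun.diff_right unit_left E)
    moreover have "(t - \<delta>) * (norm (d K))\<^sup>2 \<le> r * (norm (d K))\<^sup>2"
      "s * (norm (d K))\<^sup>2 \<le> (t + \<delta>) * (norm (d K))\<^sup>2"
      using rs by (intro mult_right_mono; simp)+
    ultimately show "\<bar>t * (norm (d K))\<^sup>2 - rinner (x (d K)) (d K)\<bar> \<le> \<delta> * (norm (d K))\<^sup>2"
      by (simp add: abs_le_iff algebra_simps)
    have "D K (x \<xi>) = x (d K)"
      by (simp add: D_def d_def blinfun.diff_left blinfun.diff_right spectral_cutD(2)[OF cut])
    moreover have "D K (d K) = d K" by (simp add: d_D orth_proj_idem \<open>orth_proj (D K)\<close>)
    ultimately show "rinner (D K (x \<xi>)) \<xi> = rinner (x (d K)) (d K)"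
      by (metis \<open>orth_proj (D K)\<close> d_D orth_proj_def selfadjointD)
  qed
  note rf = riemann_sum_form[where E = E, OF p E0 E1 E(1) mono]
  have "rinner (x \<xi>) \<xi> = rinner (unit_op (x \<xi>)) \<xi>" by (simp add: unit_left xsa)
  also have "\<dots> = (\<Sum>(t, K)\<in>p. rinner (D K (x \<xi>)) \<xi>)"
    unfolding rf(3)[of "x \<xi>", symmetric] rinner.sum_left
    by (rule sum.cong) (auto simp: D_def blinfun.diff_left)
  also have "\<dots> = (\<Sum>(t, K)\<in>p. rinner (x (d K)) (d K))"
    by (rule sum.cong) (auto simp: term_eq)
  finally have "rinner ((riemann_sum E p - x) \<xi>) \<xi>
      = (\<Sum>(t, K)\<in>p. t * (norm (d K))\<^sup>2) - (\<Sum>(t, K)\<in>p. rinner (x (d K)) (d K))"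
    by (simp add: blinfun.diff_left rinner.diff_left rf(1) d_def)
  also have "\<dots> = (\<Sum>(t, K)\<in>p. t * (norm (d K))\<^sup>2 - rinner (x (d K)) (d K))"
    by (simp add: sum_subtractf case_prod_beta)
  finally have "\<bar>rinner ((riemann_sum E p - x) \<xi>) \<xi>\<bar>
      \<le> (\<Sum>(t, K)\<in>p. \<bar>t * (norm (d K))\<^sup>2 - rinner (x (d K)) (d K)\<bar>)"
    by (simp add: sum_abs case_prod_beta)
  also have "\<dots> \<le> (\<Sum>(t, K)\<in>p. \<delta> * (norm (d K))\<^sup>2)"
    by (rule sum_mono) (auto intro: term_bd)
  also have "\<dots> = \<delta> * (\<Sum>(t, K)\<in>p. (norm (d K))\<^sup>2)"
    by (simp add: sum_distrib_left case_prod_beta)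
  also have "\<dots> = \<delta> * (norm (unit_op \<xi>))\<^sup>2"
    by (simp only: d_def rf(2))
  also have "\<dots> \<le> \<delta> * (norm \<xi>)\<^sup>2"
    by (intro mult_left_mono power_mono norm_orth_proj_le projectionsD(2) unit_proj) (use \<delta> in simp_all)
  finally show "\<bar>rinner ((riemann_sum E p - x) \<xi>) \<xi>\<bar> \<le> \<delta> * (norm \<xi>)\<^sup>2" .
qed

text \<open>
  If no cell has \<open>l\<close> in its interior, then the tags that contribute below \<open>E l\<close> are at most \<open>l\<close>, and
  the others are at least \<open>l\<close>.
\<close>

lemma spectral_cut_riemann_sum:
  assumes p: "p tagged_division_of {a..b}" "a \<le> b" and E0: "E a = 0" and E1: "E b = unit_op"
    and EP: "\<And>l. E l \<in> projections M" and mono: "monotone (\<le>) proj_le E"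
    and split: "\<And>t K. (t, K) \<in> p \<Longrightarrow> t \<le> l \<and> Sup K \<le> l \<or> l \<le> t \<and> l \<le> Inf K"
  shows "spectral_cut (riemann_sum E p) l (E l)"
proof -
  have E: "orth_proj (E l)" "E l \<in> M" for l using EP by (simp_all add: projectionsD)
  have E_min: "E r (E s \<xi>) = E (min r s) \<xi>" for r s \<xi>
    using proj_leD[OF E(1) E(1) monotoneD[OF mono], of r s \<xi>]
      proj_leD[OF E(1) E(1) monotoneD[OF mono], of s r \<xi>]
    by (cases "r \<le> s") (auto simp: min_def)
  note rf = riemann_sum_form[where E = E, OF p E0 E1 E(1) mono]
  show ?thesis
    unfolding spectral_cut_def
  proof (intro conjI allI)
    show "E l \<in> projections M" by (rule EP)
    fix \<xi>
    show "E l (riemann_sum E p \<xi>) = riemann_sum E p (E l \<xi>)"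
      unfolding riemann_sum_def blinfun.sum_left blinfun.sum_right
      by (rule sum.cong) (auto simp: blinfun.scaleR_left blinfun.scaleR_right blinfun.diff_left
          blinfun.diff_right E_min min.commute)
    define \<eta> where "\<eta> = E l \<xi>"
    have "rinner (riemann_sum E p \<eta>) \<eta> \<le> (\<Sum>(t, K)\<in>p. l * (norm (E (Sup K) \<eta> - E (Inf K) \<eta>))\<^sup>2)"
      unfolding rf(1)
    proof (rule sum_mono, clarify)
      fix t K assume tK: "(t, K) \<in> p"
      have ord: "Inf K \<le> Sup K" by (rule tagged_division_intervalE[OF p(1) tK]) simp
      show "t * (norm (E (Sup K) \<eta> - E (Inf K) \<eta>))\<^sup>2 \<le> l * (norm (E (Sup K) \<eta> - E (Inf K) \<eta>))\<^sup>2"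
        using split[OF tK]
      proof
        assume "l \<le> t \<and> l \<le> Inf K"
        then have "min (Sup K) l = l" "min (Inf K) l = l" using ord by auto
        then have "E (Sup K) \<eta> - E (Inf K) \<eta> = 0" by (simp add: \<eta>_def E_min)
        then show ?thesis by simp
      qed (auto intro: mult_right_mono)
    qed
    also have "\<dots> = l * (\<Sum>(t, K)\<in>p. (norm (E (Sup K) \<eta> - E (Inf K) \<eta>))\<^sup>2)"
      by (simp add: sum_distrib_left case_prod_beta)
    also have "\<dots> = l * (norm \<eta>)\<^sup>2"
      unfolding rf(2) by (simp add: \<eta>_def unit_left E)
    finally show "rinner (riemann_sum E p (E l \<xi>)) (E l \<xi>) \<le> l * (norm (E l \<xi>))\<^sup>2" by (simp add: \<eta>_def)
    define \<zeta> where "\<zeta> = unit_op \<xi> - E l \<xi>"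
    have "l * (norm \<zeta>)\<^sup>2 = l * (\<Sum>(t, K)\<in>p. (norm (E (Sup K) \<zeta> - E (Inf K) \<zeta>))\<^sup>2)"
      unfolding rf(2) using unit_proj
      by (simp add: \<zeta>_def blinfun.diff_right unit_left E projectionsD)
    also have "\<dots> = (\<Sum>(t, K)\<in>p. l * (norm (E (Sup K) \<zeta> - E (Inf K) \<zeta>))\<^sup>2)"
      by (simp add: sum_distrib_left case_prod_beta)
    also have "\<dots> \<le> rinner (riemann_sum E p \<zeta>) \<zeta>"
      unfolding rf(1)
    proof (rule sum_mono, clarify)
      fix t K assume tK: "(t, K) \<in> p"
      have ord: "Inf K \<le> Sup K" by (rule tagged_division_intervalE[OF p(1) tK]) simp
      show "l * (norm (E (Sup K) \<zeta> - E (Inf K) \<zeta>))\<^sup>2 \<le> t * (norm (E (Sup K) \<zeta> - E (Inf K) \<zeta>))\<^sup>2"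
        using split[OF tK]
      proof
        assume "t \<le> l \<and> Sup K \<le> l"
        then have "E (Sup K) \<zeta> - E (Inf K) \<zeta> = 0"
          using ord by (simp add: \<zeta>_def blinfun.diff_right E_min min_def unit_right E)
        then show ?thesis by simp
      qed (auto intro: mult_right_mono)
    qed
    finally show "l * (norm (unit_op \<xi> - E l \<xi>))\<^sup>2
        \<le> rinner (riemann_sum E p (unit_op \<xi> - E l \<xi>)) (unit_op \<xi> - E l \<xi>)" by (simp add: \<zeta>_def)
  qed
qed

lemma fine_tagged_division_split:
  fixes a b l \<delta> :: real
  assumes "0 < \<delta>" "a \<le> l" "l \<le> b"
  obtains p where "p tagged_division_of {a..b}" "(\<lambda>t. ball t \<delta>) fine p"
    "\<And>t K. (t, K) \<in> p \<Longrightarrow> t \<le> l \<and> Sup K \<le> l \<or> l \<le> t \<and> l \<le> Inf K"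
proof -
  have g: "gauge (\<lambda>t::real. ball t \<delta>)" using assms(1) by (simp add: gauge_ball)
  obtain p where p: "p tagged_division_of {a..l}" "(\<lambda>t. ball t \<delta>) fine p"
    using fine_division_exists[OF g, of a l] by (auto simp: cbox_interval)
  obtain q where q: "q tagged_division_of {l..b}" "(\<lambda>t. ball t \<delta>) fine q"
    using fine_division_exists[OF g, of l b] by (auto simp: cbox_interval)
  have "(p \<union> q) tagged_division_of ({a..l} \<union> {l..b})"
    by (rule tagged_division_Un[OF p(1) q(1)]) (auto simp: interior_atLeastAtMost_real)
  moreover have "{a..l} \<union> {l..b} = {a..b}" using assms by auto
  moreover have "t \<le> l \<and> Sup K \<le> l \<or> l \<le> t \<and> l \<le> Inf K" if "(t, K) \<in> p \<union> q" for t K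
    using that
  proof
    assume tK: "(t, K) \<in> p"
    show ?thesis by (rule tagged_division_intervalE[OF p(1) tK]) simp
  next
    assume tK: "(t, K) \<in> q"
    show ?thesis by (rule tagged_division_intervalE[OF q(1) tK]) simp
  qed
  ultimately show ?thesis using that[of "p \<union> q"] fine_Un[OF p(2) q(2)] by auto
qed

text \<open>
  The integral is a norm limit of Riemann sums over partitions that have \<open>l\<close> as a division point,
  and \<open>E l\<close> is a cut of each of these sums.
\<close>

lemma spectral_cut_of_integral:
  assumes int: "has_spectral_integral E a b x" and l: "a \<le> l" "l \<le> b"
    and E0: "E a = 0" and E1: "E b = unit_op"
    and EP: "\<And>l. E l \<in> projections M" and mono: "monotone (\<le>) proj_le E"
  shows "spectral_cut x l (E l)"
proof -
  have "\<exists>S. spectral_cut S l (E l) \<and> norm (S - x) < 1 / real (Suc n)" for n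
  proof -
    have "0 < 1 / real (Suc n)" by simp
    then obtain \<delta> where \<delta>: "0 < \<delta>" "\<And>p. p tagged_division_of {a..b} \<Longrightarrow> (\<lambda>t. ball t \<delta>) fine p \<Longrightarrow>
        norm (riemann_sum E p - x) < 1 / real (Suc n)"
      using int unfolding has_spectral_integral_def riemann_sum_def by meson
    obtain p where p: "p tagged_division_of {a..b}" "(\<lambda>t. ball t \<delta>) fine p"
      "\<And>t K. (t, K) \<in> p \<Longrightarrow> t \<le> l \<and> Sup K \<le> l \<or> l \<le> t \<and> l \<le> Inf K"
      using fine_tagged_division_split[OF \<delta>(1) l] by metis
    have "spectral_cut (riemann_sum E p) l (E l)"
      by (rule spectral_cut_riemann_sum[where E = E, OF p(1) _ E0 E1 EP mono p(3)]) (use l in simp_all)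
    then show ?thesis using \<delta>(2)[OF p(1,2)] by blast
  qed
  then obtain S where S: "\<And>n. spectral_cut (S n) l (E l)" "\<And>n. norm (S n - x) < 1 / real (Suc n)" by metis
  have "S \<longlonglongrightarrow> x"
  proof (rule LIM_zero_cancel, rule Lim_null_comparison)
    show "\<forall>\<^sub>F n in sequentially. norm (S n - x) \<le> 1 / real (Suc n)"
      using S(2) by (intro always_eventually allI less_imp_le)
    show "(\<lambda>n. 1 / real (Suc n)) \<longlonglongrightarrow> 0"
      using LIMSEQ_inverse_real_of_nat by (simp add: inverse_eq_divide)
  qed
  then have "strong_limit S x sequentially" by (simp add: strong_limit_def blinfun.tendsto)
  moreover have "norm (S n) \<le> norm x + 1" for n
  proof -
    have "1 / real (Suc n) \<le> 1" by simp
    then show ?thesis using norm_triangle_sub[of "S n" x] S(2)[of n] by linarith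
  qed
  ultimately show ?thesis
    by (intro spectral_cut_limit[of sequentially S "\<lambda>_. l" "\<lambda>_. E l" "norm x + 1"])
      (simp_all add: S strong_limit_def)
qed

section \<open>Spectral families\<close>

lemma is_glb_projections_iff:
  assumes A: "A \<subseteq> projections M"
  shows "is_glb (projection_poset M) P A \<longleftrightarrow> P \<in> projections M \<and> (\<forall>Q\<in>A. proj_le P Q) \<and>
    (\<forall>H\<in>projections M. (\<forall>Q\<in>A. proj_le H Q) \<longrightarrow> proj_le H P)"
proof -
  have L: "Lower (projection_poset M) A = {H \<in> projections M. \<forall>Q\<in>A. proj_le H Q}"
    using A by (auto simp: Lower_def projection_poset_def op_le_iff)
  show ?thesis
    unfolding L by (auto simp: greatest_def projection_poset_def op_le_iff)
qed

text \<open>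
  For monotone \<open>E\<close> this is \<open>E l = inf {E m | m > l}\<close>; only the inequality that does not follow from
  monotonicity is recorded.
\<close>

definition right_continuous_family :: "(real \<Rightarrow> 'h \<Rightarrow>\<^sub>L 'h) \<Rightarrow> bool"
  where "right_continuous_family E \<longleftrightarrow>
    (\<forall>l. \<forall>H\<in>projections M. (\<forall>m>l. proj_le H (E m)) \<longrightarrow> proj_le H (E l))"

text \<open>
  The integral in the definition of a spectral family can be traded for the cut inequalities. The
  family is constant beyond the norm of \<open>x\<close> by \<open>spectral_cut_below\<close> and \<open>spectral_cut_above\<close>.
\<close>

lemma is_spectral_family_iff:
  assumes x: "x \<in> sa_part M"
  shows "is_spectral_family M x E \<longleftrightarrow> (\<forall>l. spectral_cut x l (E l)) \<and> right_continuous_family E"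
proof
  assume fam: "is_spectral_family M x E"
  have EP: "E l \<in> projections M" for l using fam by (simp add: is_spectral_family_def)
  have mono: "monotone (\<le>) proj_le E"
    using fam by (simp add: monotone_def is_spectral_family_def op_le_iff[OF EP EP, symmetric])
  obtain a where a: "a > 0" "\<And>l. l < - a \<Longrightarrow> E l = 0" "\<And>l. a < l \<Longrightarrow> E l = unit_op"
    "\<And>l m. l < - a \<Longrightarrow> a < m \<Longrightarrow> has_spectral_integral E l m x"
    using fam unfolding is_spectral_family_def by blast
  have "spectral_cut x l (E l)" for l
  proof (rule spectral_cut_of_integral[OF _ _ _ _ _ EP mono])
    \<comment> \<open>an interval around \<open>l\<close> on which the integral represents \<open>x\<close>\<close>
    let ?lo = "min l (- a) - 1" and ?hi = "max l a + 1"
    show "has_spectral_integral E ?lo ?hi x" by (rule a(4)) auto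
    show "?lo \<le> l" "l \<le> ?hi" by auto
    show "E ?lo = 0" "E ?hi = unit_op" by (auto intro!: a(2,3))
  qed
  moreover have "right_continuous_family E"
    unfolding right_continuous_family_def
  proof (intro allI)
    fix l
    have sub: "E ` {l<..} \<subseteq> projections M" using EP by auto
    have "is_glb (projection_poset M) (E l) (E ` {l<..})" using fam by (simp add: is_spectral_family_def)
    then show "\<forall>H\<in>projections M. (\<forall>m>l. proj_le H (E m)) \<longrightarrow> proj_le H (E l)"
      unfolding is_glb_projections_iff[OF sub] by simp
  qed
  ultimately show "(\<forall>l. spectral_cut x l (E l)) \<and> right_continuous_family E" by blast
next
  assume R: "(\<forall>l. spectral_cut x l (E l)) \<and> right_continuous_family E"
  then have cut: "spectral_cut x l (E l)" for l by blast
  have EP: "E l \<in> projections M" for l by (rule spectral_cutD(1)[OF cut])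
  have mono: "proj_le (E l) (E m)" if "l \<le> m" for l m
    using that spectral_cut_mono[OF x cut cut, of l m] proj_le_refl[OF projectionsD(2)[OF EP]]
    by (cases "l = m") auto
  show "is_spectral_family M x E"
    unfolding is_spectral_family_def
  proof (intro conjI allI impI)
    show "E l \<in> projections M" for l by (rule EP)
    show "op_le (E l) (E m)" if "l \<le> m" for l m using mono[OF that] by (simp add: op_le_iff EP)
    show "is_glb (projection_poset M) (E l) (E ` {l<..})" for l
    proof -
      have sub: "E ` {l<..} \<subseteq> projections M" using EP by auto
      show ?thesis
        unfolding is_glb_projections_iff[OF sub] using R EP mono
        by (auto simp: right_continuous_family_def)
    qed
    show "\<exists>a>0. (\<forall>l. l < - a \<longrightarrow> E l = 0) \<and> (\<forall>l. a < l \<longrightarrow> E l = unit_op) \<and>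
      (\<forall>l m. l < - a \<and> a < m \<longrightarrow> has_spectral_integral E l m x)"
    proof (intro exI[of _ "norm x + 1"] conjI allI impI)
      show "0 < norm x + 1" by (simp add: add_nonneg_pos)
      show lo: "E l = 0" if "l < - (norm x + 1)" for l
        by (rule spectral_cut_below[OF cut]) (use that in simp)
      show hi: "E l = unit_op" if "norm x + 1 < l" for l
        by (rule spectral_cut_above[OF cut]) (use that in simp)
      fix l m assume lm: "l < - (norm x + 1) \<and> norm x + 1 < m"
      show "has_spectral_integral E l m x"
        unfolding has_spectral_integral_def riemann_sum_def[symmetric]
      proof (intro allI impI)
        fix \<epsilon> :: real assume \<epsilon>: "0 < \<epsilon>"
        have "l \<le> m" using lm norm_ge_zero[of x] by linarith
        then have "norm (riemann_sum E p - x) < \<epsilon>"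
          if "p tagged_division_of {l..m}" "(\<lambda>t. ball t (\<epsilon> / 2)) fine p" for p
          using riemann_sum_error[where E = E, OF x cut that(1) _ _ _ _ that(2)] lo[of l] hi[of m] lm \<epsilon> by simp
        then show "\<exists>\<delta>>0. \<forall>p. p tagged_division_of {l..m} \<and> (\<lambda>t. ball t \<delta>) fine p \<longrightarrow>
            norm (riemann_sum E p - x) < \<epsilon>"
          using \<epsilon> by (intro exI[of _ "\<epsilon> / 2"]) simp
      qed
    qed
  qed
qed

lemma directed_right: "directed_set {l<..} (\<lambda>s t. t \<le> (s::real))"
  unfolding directed_set_def
proof (intro conjI ballI)
  show "\<exists>c\<in>{l<..}. c \<le> a \<and> c \<le> b" if "a \<in> {l<..}" "b \<in> {l<..}" for a b
    using that by (intro bexI[of _ "min a b"]) auto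
qed (auto simp: reflp_on_def transp_on_def intro: gt_ex)

lemma tendsto_right_net: "((\<lambda>m. m) \<longlongrightarrow> l) (net_filter {l<..} (\<lambda>s t. t \<le> (s::real)))"
proof (rule tendstoI)
  fix \<epsilon> :: real assume "0 < \<epsilon>"
  then show "\<forall>\<^sub>F m in net_filter {l<..} (\<lambda>s t. t \<le> s). dist m l < \<epsilon>"
    by (intro eventually_net_filterI[OF directed_right, of "l + \<epsilon> / 2"]) (auto simp: dist_real_def)
qed

text \<open>
  Every choice of cuts becomes a spectral family once it is replaced by its limits from the right,
  because these limits are again cuts.
\<close>

lemma right_regularization:
  assumes x: "x \<in> sa_part M" and R: "\<And>l. spectral_cut x l (R l)"
  obtains G where "is_spectral_family M x G"
    "\<forall>l. proj_le (R l) (G l)" "\<forall>l m. l < m \<longrightarrow> proj_le (G l) (R m)"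
proof -
  let ?F = "\<lambda>l. net_filter {l<..} (\<lambda>s t. t \<le> (s::real))"
  have RP: "R l \<in> projections M" for l by (rule spectral_cutD(1)[OF R])
  have mono: "proj_le (R l) (R m)" if "l \<le> m" for l m
    using that spectral_cut_mono[OF x R R, of l m] proj_le_refl[OF projectionsD(2)[OF RP]]
    by (cases "l = m") auto
  have "\<exists>Q. strong_limit R Q (?F l) \<and> Q \<in> projections M" for l
    by (rule projection_net_limit[OF directed_right[of l] RP]) (auto intro: mono)
  then obtain G where G: "\<And>l. strong_limit R (G l) (?F l)" "\<And>l. G l \<in> projections M" by metis
  note nb = net_filter_not_bot[OF directed_right]
  have cut: "spectral_cut x l (G l)" for l
    by (rule spectral_cut_limit[of "?F l" "\<lambda>_. x" "\<lambda>m. m" R "norm x"])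
      (simp_all add: nb R G tendsto_right_net strong_limit_def[of "\<lambda>_. x"])
  have above: "proj_le H (G l)" if "\<And>m. l < m \<Longrightarrow> proj_le H (R m)" for H l
    by (rule strong_limit_proj_le_right[OF nb G(1)])
      (use eventually_net_in[OF directed_right] in \<open>eventually_elim, simp add: that\<close>)
  have below: "proj_le (G l) (R m)" if "l < m" for l m
    by (rule spectral_cut_mono[OF x cut R that])
  have "right_continuous_family G"
    unfolding right_continuous_family_def
  proof (intro allI ballI impI)
    fix l H assume H: "H \<in> projections M" "\<forall>m>l. proj_le H (G m)"
    show "proj_le H (G l)"
    proof (rule above)
      fix m assume "l < m"
      then obtain k where "l < k" "k < m" using dense by blast
      then show "proj_le H (R m)" using H(2) below proj_le_trans by blast
    qed
  qed
  then have "is_spectral_family M x G" by (simp add: is_spectral_family_iff[OF x] cut)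
  moreover have "proj_le (R l) (G l)" for l by (rule above) (simp add: mono)
  ultimately show ?thesis using that below by blast
qed

lemma exists_spectral_family:
  assumes x: "x \<in> sa_part M"
  shows "\<exists>E. is_spectral_family M x E"
proof -
  have "\<exists>P. spectral_cut x l P" for l using exists_spectral_cut x by (metis sa_part_iff)
  then obtain R where "\<And>l. spectral_cut x l (R l)" by metis
  then show ?thesis using right_regularization[OF x] by metis
qed

lemma spectral_family_unique:
  assumes x: "x \<in> sa_part M" and E: "is_spectral_family M x E" and E': "is_spectral_family M x E'"
  shows "E = E'"
proof -
  have le: "proj_le (E l) (E' l)" if "is_spectral_family M x E" "is_spectral_family M x E'" for E E' l
  proof -
    have c: "spectral_cut x m (E m)" "spectral_cut x m (E' m)" for m
      using that by (simp_all add: is_spectral_family_iff[OF x])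
    have "right_continuous_family E'" using that(2) by (simp add: is_spectral_family_iff[OF x])
    moreover have "proj_le (E l) (E' m)" if "l < m" for m by (rule spectral_cut_mono[OF x c that])
    ultimately show ?thesis
      using spectral_cutD(1)[OF c(1)] by (simp add: right_continuous_family_def)
  qed
  have P: "orth_proj (E l)" "orth_proj (E' l)" for l
    using E E' by (simp_all add: is_spectral_family_def projectionsD)
  show ?thesis by (rule ext) (intro proj_le_antisym le E E' P)
qed

lemma is_spectral_family_spectral_family:
  assumes x: "x \<in> sa_part M"
  shows "is_spectral_family M x (spectral_family M x)"
  unfolding spectral_family_def
  by (rule theI'[where P = "is_spectral_family M x"]) (use exists_spectral_family[OF x] spectral_family_unique[OF x] in blast)

lemma spectral_family_eq:
  "x \<in> sa_part M \<Longrightarrow> is_spectral_family M x E \<Longrightarrow> spectral_family M x = E"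
  using is_spectral_family_spectral_family spectral_family_unique by blast

lemma spectral_cut_spectral_family: "x \<in> sa_part M \<Longrightarrow> spectral_cut x l (spectral_family M x l)"
  using is_spectral_family_spectral_family is_spectral_family_iff by blast

lemma spectral_family_projections: "x \<in> sa_part M \<Longrightarrow> spectral_family M x l \<in> projections M"
  by (rule spectral_cutD(1)[OF spectral_cut_spectral_family])

lemma proj_le_spectral_familyI:
  assumes "x \<in> sa_part M" "H \<in> projections M" "\<And>m. l < m \<Longrightarrow> proj_le H (spectral_family M x m)"
  shows "proj_le H (spectral_family M x l)"
  using is_spectral_family_spectral_family[OF assms(1)] assms(2,3)
  by (simp add: is_spectral_family_iff[OF assms(1)] right_continuous_family_def)

text \<open>
  Both operators are approximated by the same Riemann sums.
\<close>

lemma spectral_family_determines: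
  assumes x: "x \<in> sa_part M" and y: "y \<in> sa_part M" and eq: "spectral_family M x = spectral_family M y"
  shows "x = y"
proof -
  define E where "E = spectral_family M x"
  have cx: "spectral_cut x l (E l)" and cy: "spectral_cut y l (E l)" for l
    using spectral_cut_spectral_family[OF x] spectral_cut_spectral_family[OF y] by (simp_all add: E_def eq)
  define b where "b = norm x + 1"
  have b: "b > 0" "E (- b) = 0" "E b = unit_op"
    using spectral_cut_below[OF cx, of "- b"] spectral_cut_above[OF cx, of b]
    by (simp_all add: b_def add_nonneg_pos)
  have "norm (x - y) \<le> 0"
  proof (rule field_le_epsilon)
    fix \<epsilon> :: real assume \<epsilon>: "0 < \<epsilon>"
    then obtain p where p: "p tagged_division_of {- b..b}" "(\<lambda>t. ball t (\<epsilon> / 2)) fine p"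
      using fine_division_exists[of "\<lambda>t. ball t (\<epsilon> / 2)" "- b" b] by (auto simp: cbox_interval gauge_ball)
    have "norm (riemann_sum E p - x) \<le> \<epsilon> / 2" "norm (riemann_sum E p - y) \<le> \<epsilon> / 2"
      using b \<epsilon> by (intro riemann_sum_error[where E = E, OF x cx p(1) _ _ _ _ p(2)]
          riemann_sum_error[where E = E, OF y cy p(1) _ _ _ _ p(2)]; simp)+
    then show "norm (x - y) \<le> 0 + \<epsilon>"
      using norm_triangle_ineq4[of "riemann_sum E p - y" "riemann_sum E p - x"] by simp
  qed
  then show ?thesis by simp
qed

section \<open>Nets of self-adjoint operators whose spectral families converge\<close>

lemma spectral_le_iff:
  assumes "x \<in> sa_part M" "y \<in> sa_part M"
  shows "spectral_le M x y \<longleftrightarrow> (\<forall>l. proj_le (spectral_family M y l) (spectral_family M x l))"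
  by (simp add: spectral_le_def op_le_iff spectral_family_projections assms)

lemma spectral_le_antisym:
  assumes x: "x \<in> sa_part M" and y: "y \<in> sa_part M" and le: "spectral_le M x y" "spectral_le M y x"
  shows "x = y"
proof (rule spectral_family_determines[OF x y], rule ext)
  show "spectral_family M x l = spectral_family M y l" for l
    using le unfolding spectral_le_iff[OF x y] spectral_le_iff[OF y x]
    by (intro proj_le_antisym projectionsD(2) spectral_family_projections x y) blast+
qed

lemma strong_limit_riemann_sum:
  assumes "\<And>l. strong_limit (\<lambda>i. E i l) (F l) \<F>"
  shows "strong_limit (\<lambda>i. riemann_sum (E i) p) (riemann_sum F p) \<F>"
  unfolding strong_limit_def riemann_sum_def blinfun.sum_left
  by (auto intro!: tendsto_sum tendsto_diff strong_limitD[OF assms] tendsto_scaleR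
      simp: blinfun.scaleR_left blinfun.diff_left case_prod_beta)

text \<open>
  The common analytic part of both halves of the theorem. The limit \<open>F\<close> of the spectral families
  need not be right-continuous, so it is only sandwiched with the spectral family of the limit.
\<close>

lemma spectral_family_net_limit:
  assumes I: "directed_set I r" and x: "\<And>i. i \<in> I \<Longrightarrow> x i \<in> sa_part M" and k: "k \<in> I"
    and lo: "\<And>i l. i \<in> I \<Longrightarrow> r k i \<Longrightarrow> l < - A \<Longrightarrow> spectral_family M (x i) l = 0"
    and hi: "\<And>i l. i \<in> I \<Longrightarrow> r k i \<Longrightarrow> A < l \<Longrightarrow> spectral_family M (x i) l = unit_op"
    and A: "0 \<le> A"
    and F: "\<And>l. strong_limit (\<lambda>i. spectral_family M (x i) l) (F l) (net_filter I r)"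
  shows "\<exists>X\<in>sa_part M. strong_limit x X (net_filter I r) \<and> (\<forall>l. proj_le (F l) (spectral_family M X l)) \<and>
    (\<forall>l m. l < m \<longrightarrow> proj_le (spectral_family M X l) (F m))"
proof -
  \<comment> \<open>the families take their extreme values strictly outside \<open>[-A, A]\<close>\<close>
  let ?N = "net_filter I r" and ?B = "A + 1"
  define E where "E i = spectral_family M (x i)" for i
  have N: "?N \<noteq> bot" by (rule net_filter_not_bot[OF I])
  have tail: "\<forall>\<^sub>F i in ?N. i \<in> I \<and> r k i" by (rule eventually_net_filterI[OF I k]) simp
  have cut: "spectral_cut (x i) l (E i l)" if "i \<in> I" for i l
    unfolding E_def by (rule spectral_cut_spectral_family[OF x[OF that]])
  have ends: "E i (- ?B) = 0" "E i ?B = unit_op" if "i \<in> I" "r k i" for i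
    unfolding E_def using that by (auto intro: lo hi)
  have norm_x: "norm (x i) \<le> ?B" if "i \<in> I \<and> r k i" for i
  proof (rule norm_le_of_spectral_cuts)
    show "spectral_cut (x i) (- ?B) 0" using cut[of i "- ?B"] ends(1)[of i] that by simp
    show "spectral_cut (x i) ?B unit_op" using cut[of i ?B] ends(2)[of i] that by simp
  qed (use that x A in auto)
  have bd: "\<forall>\<^sub>F i in ?N. norm (x i) \<le> ?B" using tail by eventually_elim (rule norm_x)
  have C: "\<exists>P. eventually P ?N \<and> (\<forall>i j. P i \<and> P j \<longrightarrow> dist (x i \<xi>) (x j \<xi>) < \<epsilon>)"
    if \<epsilon>: "0 < \<epsilon>" for \<epsilon> \<xi>
  proof -
    \<comment> \<open>mesh for which the norm error at \<open>\<xi>\<close> is at most \<open>\<epsilon> / 4\<close>, also when \<open>\<xi> = 0\<close>\<close>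
    define \<delta> where "\<delta> = \<epsilon> / 4 / (norm \<xi> + 1)"
    have n: "0 < norm \<xi> + 1" by (simp add: add_nonneg_pos)
    then have \<delta>: "0 < \<delta>" using \<epsilon> by (simp add: \<delta>_def)
    have \<delta>_norm: "\<delta> * norm \<xi> \<le> \<epsilon> / 4"
    proof -
      have "\<delta> * norm \<xi> \<le> \<delta> * (norm \<xi> + 1)" using \<delta> by simp
      also have "\<dots> = \<epsilon> / 4" by (metis \<delta>_def less_irrefl n nonzero_divide_eq_eq)
      finally show ?thesis .
    qed
    obtain p where p: "p tagged_division_of {- ?B..?B}" "(\<lambda>t. ball t \<delta>) fine p"
      using fine_division_exists[of "\<lambda>t. ball t \<delta>" "- ?B" ?B] \<delta> by (auto simp: cbox_interval gauge_ball)
    let ?c = "riemann_sum F p \<xi>"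
    have approx: "dist (x i \<xi>) (riemann_sum (E i) p \<xi>) \<le> \<epsilon> / 4" if "i \<in> I \<and> r k i" for i
    proof -
      have "norm (riemann_sum (E i) p - x i) \<le> \<delta>"
        by (rule riemann_sum_error[where E = "E i", OF x cut p(1) _ ends \<delta> p(2)]) (use that A in auto)
      then have "norm ((riemann_sum (E i) p - x i) \<xi>) \<le> \<delta> * norm \<xi>"
        by (meson norm_blinfun mult_right_mono norm_ge_zero order_trans)
      then show ?thesis using \<delta>_norm by (simp add: dist_norm norm_minus_commute blinfun.diff_left)
    qed
    have "((\<lambda>i. riemann_sum (E i) p \<xi>) \<longlongrightarrow> ?c) ?N"
      by (rule strong_limitD[OF strong_limit_riemann_sum]) (simp add: E_def F)
    then have "\<forall>\<^sub>F i in ?N. dist (riemann_sum (E i) p \<xi>) ?c < \<epsilon> / 4"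
      using \<epsilon> by (intro tendstoD) simp_all
    with tail have "\<forall>\<^sub>F i in ?N. dist (x i \<xi>) ?c < \<epsilon> / 2"
    proof eventually_elim
      case (elim i)
      show ?case
        using dist_triangle[of "x i \<xi>" ?c "riemann_sum (E i) p \<xi>"] approx[of i] elim by simp
    qed
    moreover have "dist (x i \<xi>) (x j \<xi>) < \<epsilon>" if "dist (x i \<xi>) ?c < \<epsilon> / 2" "dist (x j \<xi>) ?c < \<epsilon> / 2" for i j
      by (rule dist_triangle_half_l[OF that])
    ultimately show ?thesis by (intro exI[of _ "\<lambda>i. dist (x i \<xi>) ?c < \<epsilon> / 2"]) blast
  qed
  have "\<exists>\<eta>. ((\<lambda>i. x i \<xi>) \<longlongrightarrow> \<eta>) ?N" for \<xi>
  proof -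
    obtain \<eta> where "((\<lambda>i. x i \<xi>) \<longlongrightarrow> \<eta>) ?N" by (rule convergentI_Cauchy_filter[OF N C])
    then show ?thesis by blast
  qed
  then obtain X where X: "strong_limit x X ?N" by (rule strong_limit_exists[OF N bd])
  have "\<forall>\<^sub>F i in ?N. x i \<in> M" "\<forall>\<^sub>F i in ?N. selfadjoint (x i)"
    using eventually_net_in[OF I] by (eventually_elim, use x in \<open>simp add: sa_part_iff\<close>)+
  then have XM: "X \<in> sa_part M"
    unfolding sa_part_iff using M_strong_limit[OF N _ X] strong_limit_selfadjoint[OF N X] by blast
  have "spectral_cut X l (F l)" for l
  proof (rule spectral_cut_limit[OF N _ bd X F tendsto_const])
    show "\<forall>\<^sub>F i in ?N. spectral_cut (x i) l (spectral_family M (x i) l)"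
      using eventually_net_in[OF I] by eventually_elim (rule cut[unfolded E_def])
  qed
  then obtain G where G: "is_spectral_family M X G"
    "\<forall>l. proj_le (F l) (G l)" "\<forall>l m. l < m \<longrightarrow> proj_le (G l) (F m)"
    by (rule right_regularization[OF XM])
  show ?thesis
    by (intro bexI[of _ X]) (simp_all add: XM X spectral_family_eq[OF XM G(1)] G(2,3))
qed

lemma is_glb_spectral_iff:
  assumes A: "A \<subseteq> sa_part M"
  shows "is_glb (spectral_poset M) X A \<longleftrightarrow> X \<in> sa_part M \<and> (\<forall>y\<in>A. spectral_le M X y) \<and>
    (\<forall>z\<in>sa_part M. (\<forall>y\<in>A. spectral_le M z y) \<longrightarrow> spectral_le M z X)"
proof -
  have L: "Lower (spectral_poset M) A = {z \<in> sa_part M. \<forall>y\<in>A. spectral_le M z y}"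
    using A by (auto simp: Lower_def spectral_poset_def)
  show ?thesis unfolding L by (auto simp: greatest_def spectral_poset_def)
qed

lemma is_lub_spectral_iff:
  assumes A: "A \<subseteq> sa_part M"
  shows "is_lub (spectral_poset M) X A \<longleftrightarrow> X \<in> sa_part M \<and> (\<forall>y\<in>A. spectral_le M y X) \<and>
    (\<forall>z\<in>sa_part M. (\<forall>y\<in>A. spectral_le M y z) \<longrightarrow> spectral_le M X z)"
proof -
  have L: "Upper (spectral_poset M) A = {z \<in> sa_part M. \<forall>y\<in>A. spectral_le M y z}"
    using A by (auto simp: Upper_def spectral_poset_def)
  show ?thesis unfolding L by (auto simp: least_def spectral_poset_def)
qed

lemma spectral_inf_eq:
  assumes A: "A \<subseteq> sa_part M" and X: "is_glb (spectral_poset M) X A"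
  shows "\<Sqinter>\<^bsub>spectral_poset M\<^esub> A = X"
proof -
  have Y: "is_glb (spectral_poset M) (\<Sqinter>\<^bsub>spectral_poset M\<^esub> A) A"
    unfolding Lattice.inf_def by (rule someI[where P = "\<lambda>X. is_glb (spectral_poset M) X A", OF X])
  show ?thesis
    using X Y unfolding is_glb_spectral_iff[OF A] by (intro spectral_le_antisym) blast+
qed

lemma spectral_sup_eq:
  assumes A: "A \<subseteq> sa_part M" and X: "is_lub (spectral_poset M) X A"
  shows "\<Squnion>\<^bsub>spectral_poset M\<^esub> A = X"
proof -
  have Y: "is_lub (spectral_poset M) (\<Squnion>\<^bsub>spectral_poset M\<^esub> A) A"
    unfolding Lattice.sup_def by (rule someI[where P = "\<lambda>X. is_lub (spectral_poset M) X A", OF X])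
  show ?thesis
    using X Y unfolding is_lub_spectral_iff[OF A] by (intro spectral_le_antisym) blast+
qed

lemma limitin_sot_net:
  assumes I: "directed_set I r" and x: "\<And>i. i \<in> I \<Longrightarrow> x i \<in> sa_part M"
    and X: "X \<in> sa_part M" "strong_limit x X (net_filter I r)"
  shows "limitin sot x X (net_filter I r)"
proof -
  have "\<forall>\<^sub>F i in net_filter I r. x i \<in> bounded_ops"
    using eventually_net_in[OF I] by eventually_elim (use x M_bounded_ops in \<open>simp add: sa_part_iff\<close>)
  then show ?thesis using X M_bounded_ops by (simp add: limitin_sot sa_part_iff)
qed

text \<open>
  A bound in the spectral order bounds the spectrum; with the next lemma this provides the
  common interval for a tail of the net.
\<close>

lemma spectral_family_eq_0:
  assumes x: "x \<in> sa_part M" and y: "y \<in> sa_part M" and le: "spectral_le M y x" and l: "l < - norm y"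
  shows "spectral_family M x l = 0"
proof (rule blinfun_eqI)
  have "spectral_family M y l = 0" by (rule spectral_cut_below[OF spectral_cut_spectral_family[OF y] l])
  then have "proj_le (spectral_family M x l) 0" using le by (metis spectral_le_iff[OF y x])
  then show "spectral_family M x l \<xi> = blinfun_apply 0 \<xi>" for \<xi> by (simp add: proj_le_def)
qed

lemma spectral_family_eq_unit:
  assumes x: "x \<in> sa_part M" and y: "y \<in> sa_part M" and le: "spectral_le M x y" and l: "norm y < l"
  shows "spectral_family M x l = unit_op"
proof (rule proj_le_antisym)
  have "spectral_family M y l = unit_op" by (rule spectral_cut_above[OF spectral_cut_spectral_family[OF y] l])
  then show "proj_le unit_op (spectral_family M x l)" using le by (metis spectral_le_iff[OF x y])
qed (simp_all add: proj_le_unit spectral_family_projections x projectionsD(2) unit_proj)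

text \<open>
  Going down in the spectral order means that the spectral projections increase, so \<open>F l\<close> is here the
  supremum of the projections at \<open>l\<close>. It need not be right-continuous, and a lower bound \<open>y\<close> of the
  net is compared with \<open>X\<close> through right-continuity of the family of \<open>y\<close>.
\<close>

lemma decreasing_net:
  assumes I: "directed_set I r" and x: "\<And>i. i \<in> I \<Longrightarrow> x i \<in> sa_part M"
    and dec: "\<And>i j. i \<in> I \<Longrightarrow> j \<in> I \<Longrightarrow> r i j \<Longrightarrow> spectral_le M (x j) (x i)"
    and z: "z \<in> sa_part M" "\<And>i. i \<in> I \<Longrightarrow> spectral_le M z (x i)"
  obtains X where "is_glb (spectral_poset M) X (x ` I)" "limitin sot x X (net_filter I r)"
proof -
  let ?E = "\<lambda>i. spectral_family M (x i)" and ?N = "net_filter I r"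
  note N = net_filter_not_bot[OF I]
  obtain k where k: "k \<in> I" using I by (auto simp: directed_set_def)
  have mono: "proj_le (?E i l) (?E j l)" if "i \<in> I" "j \<in> I" "r i j" for i j l
    using dec[OF that] spectral_le_iff[OF x x] that by blast
  have "\<exists>Q. strong_limit (\<lambda>i. ?E i l) Q ?N" for l
    by (rule projection_net_limit[OF I, of "\<lambda>i. ?E i l"])
      (auto simp: spectral_family_projections x mono)
  then obtain F where F: "\<And>l. strong_limit (\<lambda>i. ?E i l) (F l) ?N" by metis
  \<comment> \<open>the bound \<open>z\<close> controls one end of the spectra of the tail after \<open>k\<close>, the member \<open>x k\<close> the other\<close>
  define A where "A = max (norm z) (norm (x k))"
  have "\<exists>X\<in>sa_part M. strong_limit x X ?N \<and> (\<forall>l. proj_le (F l) (spectral_family M X l)) \<and>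
    (\<forall>l m. l < m \<longrightarrow> proj_le (spectral_family M X l) (F m))"
  proof (rule spectral_family_net_limit[OF I x k _ _ _ F, of A])
    show "?E i l = 0" if "i \<in> I" "r k i" "l < - A" for i l
      by (rule spectral_family_eq_0[OF x z(1) z(2)]) (use that in \<open>auto simp: A_def\<close>)
    show "?E i l = unit_op" if "i \<in> I" "r k i" "A < l" for i l
      by (rule spectral_family_eq_unit[OF x x dec, of i k]) (use that k in \<open>auto simp: A_def\<close>)
    show "0 \<le> A" by (simp add: A_def le_max_iff_disj)
  qed
  then obtain X where X: "X \<in> sa_part M" "strong_limit x X ?N"
    and F_le_X: "\<forall>l. proj_le (F l) (spectral_family M X l)"
    and X_le_F: "\<forall>l m. l < m \<longrightarrow> proj_le (spectral_family M X l) (F m)"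
    by blast
  have le_F: "proj_le (?E i l) (F l)" if "i \<in> I" for i l
    by (rule strong_limit_proj_le_right[OF N F], rule eventually_net_filterI[OF I that]) (rule mono[OF that])
  have sub: "x ` I \<subseteq> sa_part M" using x by blast
  have "is_glb (spectral_poset M) X (x ` I)"
    unfolding is_glb_spectral_iff[OF sub]
  proof (intro conjI ballI impI X(1))
    fix y assume "y \<in> x ` I"
    then show "spectral_le M X y"
      using spectral_le_iff[OF X(1) x] proj_le_trans[OF le_F F_le_X[rule_format]] by auto
  next
    fix y assume y: "y \<in> sa_part M" "\<forall>w\<in>x ` I. spectral_le M y w"
    then have "proj_le (?E i l) (spectral_family M y l)" if "i \<in> I" for i l
      using that spectral_le_iff[OF y(1) x] by blast
    then have F_le_y: "proj_le (F l) (spectral_family M y l)" for l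
      by (intro strong_limit_proj_le_left[OF N F]) (use eventually_net_in[OF I] in \<open>eventually_elim, simp\<close>)
    have "proj_le (spectral_family M X l) (spectral_family M y l)" for l
      by (rule proj_le_spectral_familyI[OF y(1) spectral_family_projections[OF X(1)]])
        (rule proj_le_trans[OF X_le_F[rule_format] F_le_y])
    then show "spectral_le M y X" by (simp add: spectral_le_iff y(1) X(1))
  qed
  then show ?thesis using limitin_sot_net[OF I x X(1,2)] by (rule that)
qed

text \<open>
  The spectral projections now decrease to \<open>F l\<close>. Right-continuity of the families of the members
  is what shows that \<open>X\<close> is an upper bound.
\<close>

lemma increasing_net:
  assumes I: "directed_set I r" and x: "\<And>i. i \<in> I \<Longrightarrow> x i \<in> sa_part M"
    and inc: "\<And>i j. i \<in> I \<Longrightarrow> j \<in> I \<Longrightarrow> r i j \<Longrightarrow> spectral_le M (x i) (x j)"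
    and z: "z \<in> sa_part M" "\<And>i. i \<in> I \<Longrightarrow> spectral_le M (x i) z"
  obtains X where "is_lub (spectral_poset M) X (x ` I)" "limitin sot x X (net_filter I r)"
proof -
  let ?E = "\<lambda>i. spectral_family M (x i)" and ?N = "net_filter I r"
  note N = net_filter_not_bot[OF I]
  obtain k where k: "k \<in> I" using I by (auto simp: directed_set_def)
  have mono: "proj_le (?E j l) (?E i l)" if "i \<in> I" "j \<in> I" "r i j" for i j l
    using inc[OF that] spectral_le_iff[OF x x] that by blast
  have "\<exists>Q. strong_limit (\<lambda>i. ?E i l) Q ?N" for l
    by (rule projection_net_limit[OF I, of "\<lambda>i. ?E i l"])
      (auto simp: spectral_family_projections x mono)
  then obtain F where F: "\<And>l. strong_limit (\<lambda>i. ?E i l) (F l) ?N" by metis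
  \<comment> \<open>the bound \<open>z\<close> controls one end of the spectra of the tail after \<open>k\<close>, the member \<open>x k\<close> the other\<close>
  define A where "A = max (norm z) (norm (x k))"
  have "\<exists>X\<in>sa_part M. strong_limit x X ?N \<and> (\<forall>l. proj_le (F l) (spectral_family M X l)) \<and>
    (\<forall>l m. l < m \<longrightarrow> proj_le (spectral_family M X l) (F m))"
  proof (rule spectral_family_net_limit[OF I x k _ _ _ F, of A])
    show "?E i l = 0" if "i \<in> I" "r k i" "l < - A" for i l
      by (rule spectral_family_eq_0[OF x x inc, of i k]) (use that k in \<open>auto simp: A_def\<close>)
    show "?E i l = unit_op" if "i \<in> I" "r k i" "A < l" for i l
      by (rule spectral_family_eq_unit[OF x z(1) z(2)]) (use that in \<open>auto simp: A_def\<close>)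
    show "0 \<le> A" by (simp add: A_def le_max_iff_disj)
  qed
  then obtain X where X: "X \<in> sa_part M" "strong_limit x X ?N"
    and F_le_X: "\<forall>l. proj_le (F l) (spectral_family M X l)"
    and X_le_F: "\<forall>l m. l < m \<longrightarrow> proj_le (spectral_family M X l) (F m)"
    by blast
  have F_le: "proj_le (F l) (?E i l)" if "i \<in> I" for i l
    by (rule strong_limit_proj_le_left[OF N F], rule eventually_net_filterI[OF I that]) (rule mono[OF that])
  have sub: "x ` I \<subseteq> sa_part M" using x by blast
  have "is_lub (spectral_poset M) X (x ` I)"
    unfolding is_lub_spectral_iff[OF sub]
  proof (intro conjI ballI impI X(1))
    fix y assume "y \<in> x ` I"
    then obtain i where i: "i \<in> I" "y = x i" by blast
    have "proj_le (spectral_family M X l) (?E i l)" for l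
      by (rule proj_le_spectral_familyI[OF x[OF i(1)] spectral_family_projections[OF X(1)]])
        (rule proj_le_trans[OF X_le_F[rule_format] F_le[OF i(1)]])
    then show "spectral_le M y X" by (simp add: spectral_le_iff x i X(1))
  next
    fix y assume y: "y \<in> sa_part M" "\<forall>w\<in>x ` I. spectral_le M w y"
    then have "proj_le (spectral_family M y l) (?E i l)" if "i \<in> I" for i l
      using that spectral_le_iff[OF x y(1)] by blast
    then have "proj_le (spectral_family M y l) (F l)" for l
      by (intro strong_limit_proj_le_right[OF N F]) (use eventually_net_in[OF I] in \<open>eventually_elim, simp\<close>)
    then have "proj_le (spectral_family M y l) (spectral_family M X l)" for l
      using F_le_X[rule_format] by (rule proj_le_trans)
    then show "spectral_le M X y" by (simp add: spectral_le_iff y(1) X(1))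
  qed
  then show ?thesis using limitin_sot_net[OF I x X(1,2)] by (rule that)
qed

end

theorem theorem2p4:
  fixes M :: "('h::chilbert_space \<Rightarrow>\<^sub>L 'h) set"
    and I :: "'i set" and r :: "'i \<Rightarrow> 'i \<Rightarrow> bool" and x :: "'i \<Rightarrow> 'h \<Rightarrow>\<^sub>L 'h"
  assumes "von_neumann_algebra M"
    and "directed_set I r"
    and "\<forall>a\<in>I. x a \<in> sa_part M"
  shows "((\<forall>a\<in>I. \<forall>b\<in>I. r a b \<longrightarrow> spectral_le M (x b) (x a)) \<and>
          (\<exists>z\<in>sa_part M. \<forall>a\<in>I. spectral_le M z (x a)) \<longrightarrow>
          is_glb (spectral_poset M) (\<Sqinter>\<^bsub>spectral_poset M\<^esub> (x ` I)) (x ` I) \<and>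
          limitin sot x (\<Sqinter>\<^bsub>spectral_poset M\<^esub> (x ` I)) (net_filter I r)) \<and>
         ((\<forall>a\<in>I. \<forall>b\<in>I. r a b \<longrightarrow> spectral_le M (x a) (x b)) \<and>
          (\<exists>z\<in>sa_part M. \<forall>a\<in>I. spectral_le M (x a) z) \<longrightarrow>
          is_lub (spectral_poset M) (\<Squnion>\<^bsub>spectral_poset M\<^esub> (x ` I)) (x ` I) \<and>
          limitin sot x (\<Squnion>\<^bsub>spectral_poset M\<^esub> (x ` I)) (net_filter I r))"
proof -
  interpret von_neumann M by unfold_locales (rule assms(1))
  have sub: "x ` I \<subseteq> sa_part M" using assms(3) by blast
  show ?thesis
  proof (rule conjI; intro impI; elim conjE bexE)
    fix z
    assume dec: "\<forall>a\<in>I. \<forall>b\<in>I. r a b \<longrightarrow> spectral_le M (x b) (x a)"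
      and z: "z \<in> sa_part M" "\<forall>a\<in>I. spectral_le M z (x a)"
    obtain X where X: "is_glb (spectral_poset M) X (x ` I)" "limitin sot x X (net_filter I r)"
      by (rule decreasing_net[OF assms(2), of x z]) (use assms(3) dec z in blast)+
    then show "is_glb (spectral_poset M) (\<Sqinter>\<^bsub>spectral_poset M\<^esub> (x ` I)) (x ` I) \<and>
        limitin sot x (\<Sqinter>\<^bsub>spectral_poset M\<^esub> (x ` I)) (net_filter I r)"
      unfolding spectral_inf_eq[OF sub X(1)] by blast
  next
    fix z
    assume inc: "\<forall>a\<in>I. \<forall>b\<in>I. r a b \<longrightarrow> spectral_le M (x a) (x b)"
      and z: "z \<in> sa_part M" "\<forall>a\<in>I. spectral_le M (x a) z"
    obtain X where X: "is_lub (spectral_poset M) X (x ` I)" "limitin sot x X (net_filter I r)"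
      by (rule increasing_net[OF assms(2), of x z]) (use assms(3) inc z in blast)+
    then show "is_lub (spectral_poset M) (\<Squnion>\<^bsub>spectral_poset M\<^esub> (x ` I)) (x ` I) \<and>
        limitin sot x (\<Squnion>\<^bsub>spectral_poset M\<^esub> (x ` I)) (net_filter I r)"
      unfolding spectral_sup_eq[OF sub X(1)] by blast
  qed
qed

end
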